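(* Let $P_{Y|X}$ be a discrete memoryless channel with finite alphabets, capacity $C>0$ and $C_1<\infty$. Fix $\epsilon\in(0,1)$. Then, as $N\to\infty$, $$\log M^*(N,\epsilon)\ \ge\ \frac{NC}{1-\epsilon}-\frac{C}{C_1}\log N-\log\log N+O(1).$$
   Context: All logarithms are natural. $C=\max_{P_X}I(P_X,P_{Y|X})$ is the capacity and $C_1\triangleq\max_{(x,x')\in\mathcal{X}^2}D(P_{Y|X=x}\|P_{Y|X=x'})$, where $D$ is the Kullback–Leibler divergence. Noiseless feedback of past channel outputs is available to the encoder. An $(N,M,\epsilon)$-VLF code, for $N>0$, $M\in\mathbb{N}$, $\epsilon\in(0,1)$, consists of: (1) a common randomness random variable $U$ on a finite alphabet with distribution $P_U$, revealed to transmitter and receiver before transmission; (2) encoding functions $\mathsf{f}_t$ with $X_t=\mathsf{f}_t(U,W,Y^{t-1})\in\mathcal{X}$, $t\in\mathbb{N}$, where the message $W$ is uniform on $[M]$; (3) a stopping time $\tau\in\mathbb{N}$ of the filtration generated by $\{U,Y^t\}_{t\ge0}$ with $\mathbb{E}[\tau]\le N$; (4) a decoder $\hat W=\mathsf{g}_\tau(U,Y^\tau)\in[M]$ with $\Pr[\hat W\ne W]\le\epsilon$. The code may depend on $P_{Y|X}$. $M^*(N,\epsilon)$ is the largest $M$ for which an $(N,M,\epsilon)$-VLF code exists. *)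

theory Defs
  imports "HOL-Probability.Probability"
begin

(* Discrete memoryless channel: W x = P_{Y|X=x}, finite alphabets 'x, 'y. *)

definition mutual_info :: "'x::finite pmf \<Rightarrow> ('x \<Rightarrow> 'y::finite pmf) \<Rightarrow> real" where
  "mutual_info P W =
     (\<Sum>x\<in>UNIV. \<Sum>y\<in>UNIV.
        (let q = (\<Sum>x'\<in>UNIV. pmf P x' * pmf (W x') y)
         in if pmf P x * pmf (W x) y = 0 then 0
            else pmf P x * pmf (W x) y * ln (pmf (W x) y / q)))"

definition capacity :: "('x::finite \<Rightarrow> 'y::finite pmf) \<Rightarrow> real" where
  "capacity W = (SUP P. mutual_info P W)"

definition kl_div :: "'y::finite pmf \<Rightarrow> 'y pmf \<Rightarrow> ereal" where
  "kl_div p q =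
     (if (\<forall>y. pmf q y = 0 \<longrightarrow> pmf p y = 0)
      then ereal (\<Sum>y\<in>UNIV. if pmf p y = 0 then 0 else pmf p y * ln (pmf p y / pmf q y))
      else \<infinity>)"

definition C1 :: "('x::finite \<Rightarrow> 'y::finite pmf) \<Rightarrow> ereal" where
  "C1 W = Max ((\<lambda>(x, x'). kl_div (W x) (W x')) ` UNIV)"

(* VLF codes.  Common randomness U takes values in a finite subset of nat (distribution PU);
   messages are 0..<M; encoder f t u w (Y^{t-1}) gives X_t (t = 1,2,...);
   the stopping time tau is described by a stopping rule: tau = least t with stop u (Y^t)
   (tau = 0 allowed, tau = infinity if never); decoder g u (Y^tau). *)

definition path_prob ::
  "('x \<Rightarrow> 'y pmf) \<Rightarrow> (nat \<Rightarrow> nat \<Rightarrow> nat \<Rightarrow> 'y list \<Rightarrow> 'x) \<Rightarrow> nat \<Rightarrow> nat \<Rightarrow> 'y list \<Rightarrow> real" where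
  "path_prob W f u w ys = (\<Prod>i<length ys. pmf (W (f (Suc i) u w (take i ys))) (ys ! i))"

definition not_stopped :: "(nat \<Rightarrow> 'y list \<Rightarrow> bool) \<Rightarrow> nat \<Rightarrow> 'y list \<Rightarrow> bool" where
  "not_stopped stop u ys = (\<forall>k\<le>length ys. \<not> stop u (take k ys))"

definition stops_at :: "(nat \<Rightarrow> 'y list \<Rightarrow> bool) \<Rightarrow> nat \<Rightarrow> 'y list \<Rightarrow> bool" where
  "stops_at stop u ys = (stop u ys \<and> (\<forall>k<length ys. \<not> stop u (take k ys)))"

definition prob_tau_gt ::
  "('x \<Rightarrow> 'y::finite pmf) \<Rightarrow> nat \<Rightarrow> nat pmf \<Rightarrow> (nat \<Rightarrow> nat \<Rightarrow> nat \<Rightarrow> 'y list \<Rightarrow> 'x)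
   \<Rightarrow> (nat \<Rightarrow> 'y list \<Rightarrow> bool) \<Rightarrow> nat \<Rightarrow> real" where
  "prob_tau_gt W M PU f stop t =
     (\<Sum>u\<in>set_pmf PU. \<Sum>w<M. pmf PU u / real M *
        (\<Sum>ys\<in>{ys::'y list. length ys = t}.
           if not_stopped stop u ys then path_prob W f u w ys else 0))"

definition prob_correct_at ::
  "('x \<Rightarrow> 'y::finite pmf) \<Rightarrow> nat \<Rightarrow> nat pmf \<Rightarrow> (nat \<Rightarrow> nat \<Rightarrow> nat \<Rightarrow> 'y list \<Rightarrow> 'x)
   \<Rightarrow> (nat \<Rightarrow> 'y list \<Rightarrow> bool) \<Rightarrow> (nat \<Rightarrow> 'y list \<Rightarrow> nat) \<Rightarrow> nat \<Rightarrow> real" where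
  "prob_correct_at W M PU f stop g t =
     (\<Sum>u\<in>set_pmf PU. \<Sum>w<M. pmf PU u / real M *
        (\<Sum>ys\<in>{ys::'y list. length ys = t}.
           if stops_at stop u ys \<and> g u ys = w then path_prob W f u w ys else 0))"

(* (N, M, eps)-VLF code; E[tau] = sum_t Pr[tau > t];
   the event tau = infinity is counted as an error. *)
definition is_vlf_code ::
  "('x \<Rightarrow> 'y::finite pmf) \<Rightarrow> real \<Rightarrow> nat \<Rightarrow> real \<Rightarrow> nat pmf
   \<Rightarrow> (nat \<Rightarrow> nat \<Rightarrow> nat \<Rightarrow> 'y list \<Rightarrow> 'x) \<Rightarrow> (nat \<Rightarrow> 'y list \<Rightarrow> bool)
   \<Rightarrow> (nat \<Rightarrow> 'y list \<Rightarrow> nat) \<Rightarrow> bool" where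
  "is_vlf_code W N M \<epsilon> PU f stop g \<longleftrightarrow>
     M \<ge> 1 \<and> finite (set_pmf PU) \<and> (\<forall>u ys. g u ys < M) \<and>
     summable (prob_tau_gt W M PU f stop) \<and> (\<Sum>t. prob_tau_gt W M PU f stop t) \<le> N \<and>
     1 - (\<Sum>t. prob_correct_at W M PU f stop g t) \<le> \<epsilon>"

end

theory Submission
  imports Defs "HOL-Real_Asymp.Real_Asymp"
begin

text \<open>
  A deterministic feedback strategy is analysed through a potential of the posterior, in the spirit of
  Burnashev. Let \<open>l i\<close> be the posterior log odds of message \<open>i\<close>. While all \<open>l i\<close> lie below \<open>ln (ln N)\<close>,
  messages are mapped to inputs so that the log odds of the true message grow on average at rate at
  least (almost) the capacity \<open>C\<close>; a random assignment does this, so some assignment does. Once one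
  message exceeds this level, it is sent as \<open>x0\<close> and all others as \<open>x1\<close>, where \<open>(x0, x1)\<close> attains
  \<open>C1\<close>, so that its log odds grow at rate \<open>C1\<close>; only a posterior fraction \<open>1 / ln N\<close> of the
  messages does not profit from this, and over about \<open>ln N / C1\<close> steps this costs \<open>O(1)\<close>.
  The strategy halts when some \<open>l i\<close> exceeds \<open>ln N\<close>. The posterior mean of a potential with
  slope \<open>-1/C\<close> below and about \<open>-1/C1\<close> above \<open>ln (ln N)\<close> then bounds expected time plus
  \<open>N / (1 - \<epsilon>)\<close> times the error probability by
  \<open>(ln M + ln (ln N)) / C + ln N / C1 + O(1)\<close>. If this is at most \<open>N / (1 - \<epsilon>)\<close>,
  stopping at time 0 with the right probability turns the strategy into an
  \<open>(N, M, \<epsilon>)\<close> code.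
\<close>

section \<open>A potential with two slopes and controlled curvature\<close>

text \<open>The mean value theorem gives the slope \<open>1 / (1 + z^2)\<close> at some
  \<open>z\<close> within \<open>|h|\<close> of \<open>u\<close>, and
  \<open>|z + u| <= 2 * (1 + z^2)\<close> controls the move from \<open>z\<close> to
  \<open>u\<close>. The point is that the error is proportional to the slope at \<open>u\<close>, so
  it stays relatively small even where the slope is tiny.\<close>

lemma arctan_tangent_lower:
  fixes u h k :: real
  assumes h: "\<bar>h\<bar> \<le> k" and k: "k \<le> 1"
  shows "arctan (u + h) \<ge> arctan u + (h - 2 * k\<^sup>2) / (1 + u\<^sup>2)"
proof -
  obtain z where z: "\<bar>z - u\<bar> \<le> \<bar>h\<bar>" "arctan (u + h) - arctan u = h / (1 + z\<^sup>2)"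
  proof (cases h "0::real" rule: linorder_cases)
    case less
    obtain z where "u + h < z" "z < u" "arctan u - arctan (u + h) = (u - (u + h)) * inverse (1 + z\<^sup>2)"
      using MVT2[of "u + h" u arctan "\<lambda>z. inverse (1 + z\<^sup>2)"] less DERIV_arctan by auto
    then show ?thesis using that[of z] less by (auto simp: divide_inverse)
  next
    case equal
    then show ?thesis using that[of u] by simp
  next
    case greater
    obtain z where "u < z" "z < u + h" "arctan (u + h) - arctan u = (u + h - u) * inverse (1 + z\<^sup>2)"
      using MVT2[of u "u + h" arctan "\<lambda>z. inverse (1 + z\<^sup>2)"] greater DERIV_arctan by auto
    then show ?thesis using that[of z] greater by (auto simp: divide_inverse)
  qed
  have pos: "1 + z\<^sup>2 > 0" "1 + u\<^sup>2 > 0" by (simp_all add: add_pos_nonneg)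
  have "\<bar>z + u\<bar> \<le> 2 * \<bar>z\<bar> + 1" using z(1) h k by linarith
  also have "\<dots> \<le> 2 * (1 + z\<^sup>2)"
  proof -
    have "0 \<le> (\<bar>z\<bar> - 1)\<^sup>2 + z\<^sup>2" by (intro add_nonneg_nonneg) simp_all
    then show ?thesis unfolding power2_diff by (simp add: algebra_simps)
  qed
  finally have zu: "\<bar>z + u\<bar> \<le> 2 * (1 + z\<^sup>2)" .
  have "\<bar>h * (z\<^sup>2 - u\<^sup>2)\<bar> = \<bar>h\<bar> * \<bar>z - u\<bar> * \<bar>z + u\<bar>"
    by (simp add: abs_mult power2_eq_square square_diff_square_factored)
  also have "\<dots> \<le> k * k * (2 * (1 + z\<^sup>2))"
    using z(1) h zu by (intro mult_mono) auto
  finally have "h * (z\<^sup>2 - u\<^sup>2) \<le> 2 * k\<^sup>2 * (1 + z\<^sup>2)" by (simp add: power2_eq_square abs_le_iff algebra_simps)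
  then have "(h - 2 * k\<^sup>2) * (1 + z\<^sup>2) \<le> h * (1 + u\<^sup>2)" by (simp add: algebra_simps)
  then have "(h - 2 * k\<^sup>2) / (1 + u\<^sup>2) \<le> h / (1 + z\<^sup>2)"
    using pos by (simp add: divide_simps mult.commute)
  then show ?thesis using z(2) by linarith
qed

text \<open>A piecewise linear function with a kink at 0 has the wrong curvature there for a drift argument.
  Subtracting a multiple of a stretched \<open>arctan\<close>, whose slope dominates its curvature, pays for the kink
  at the price of a bounded perturbation.\<close>

lemma two_slope_potential:
  fixes B d R :: real
  assumes "0 < d" "d \<le> B" "0 \<le> R"
  obtains K L :: real where "0 \<le> K" "0 \<le> L"
    "\<And>p a. \<lbrakk>0 \<le> p; p \<le> R; 0 \<le> a; a \<le> R\<rbrakk> \<Longrightarrow> \<exists>\<phi>::real \<Rightarrow> real.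
       (\<forall>x<0. \<exists>m\<ge>0. \<forall>h. \<bar>h\<bar> \<le> B \<longrightarrow> \<phi> (x + h) \<le> \<phi> x - (p + m) * h + m * d) \<and>
       (\<forall>x\<ge>0. \<exists>m\<ge>0. \<forall>h. \<bar>h\<bar> \<le> B \<longrightarrow> \<phi> (x + h) \<le> \<phi> x - (a + m) * h + m * d) \<and>
       (\<forall>x h. \<bar>h\<bar> \<le> B \<longrightarrow> \<phi> (x + h) \<le> \<phi> x + L) \<and>
       (\<forall>x y. x \<le> y \<longrightarrow> 0 \<le> y \<longrightarrow> - a * y - K \<le> \<phi> x) \<and>
       (\<forall>x\<le>0. \<phi> x \<le> - p * x + K)"
proof
  have B: "B > 0" using assms by linarith
  \<comment> \<open>Chosen so that \<open>2 * (s * B)^2 = s * (d / 2)\<close>: the curvature of the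
    stretched \<open>arctan\<close> uses up half of the allowance \<open>m * d\<close>.\<close>
  define s where "s = d / (4 * B\<^sup>2)"
  have s: "s > 0" using assms B by (simp add: s_def)
  have sB: "s * B \<le> 1" using assms B by (simp add: s_def power2_eq_square field_simps)
  \<comment> \<open>Chosen so that within distance \<open>B\<close> of the kink the other half of
    \<open>m * d\<close> is at least \<open>R * B\<close>, a bound for the error made by crossing
    the kink.\<close>
  define A where "A = 4 * R * B / (s * d)"
  have A: "A \<ge> 0" using assms B s by (simp add: A_def)
  have As: "A * s * d = 4 * R * B" using assms s by (simp add: A_def)
  let ?K = "2 * A" and ?L = "(R + A * s) * B + A * s * d"
  show "0 \<le> ?K" using A by simp
  show "0 \<le> ?L" using A s assms B by simp
  fix p a :: real
  assume pa: "0 \<le> p" "p \<le> R" "0 \<le> a" "a \<le> R"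
  define b where "b x = (if x < 0 then - p * x else - a * x)" for x
  define \<phi> where "\<phi> x = b x - A * arctan (s * x)" for x
  \<comment> \<open>The derivative of \<open>A * arctan (s * x)\<close>, that is, the extra slope of
    the potential.\<close>
  define m where "m x = A * (s / (1 + (s * x)\<^sup>2))" for x
  have den: "1 \<le> 1 + (s * x)\<^sup>2" for x by simp
  have m0: "0 \<le> m x" for x
    using A s den[of x] by (simp add: m_def)
  have mA: "m x \<le> A * s" for x
  proof -
    have "s / (1 + (s * x)\<^sup>2) \<le> s / 1"
      using s den[of x] by (intro divide_left_mono) (auto simp: add_pos_nonneg)
    then show ?thesis using A unfolding m_def by (intro mult_left_mono) auto
  qed
  have mlow: "R * B \<le> m x * d / 2" if "\<bar>x\<bar> \<le> B" for x
  proof -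
    have "\<bar>s * x\<bar> \<le> 1" using mult_left_mono[OF that, of s] s sB unfolding abs_mult by linarith
    then have "1 + (s * x)\<^sup>2 \<le> 2" by (simp add: abs_square_le_1)
    then have "s / 2 \<le> s / (1 + (s * x)\<^sup>2)"
      using s den[of x] by (intro divide_left_mono) (auto simp: add_pos_nonneg)
    then have "A * (s / 2) \<le> m x" using A unfolding m_def by (intro mult_left_mono) auto
    then have "A * (s / 2) * d \<le> m x * d" using assms by (intro mult_right_mono) auto
    then show ?thesis using As by linarith
  qed
  have arc: "- A * arctan (s * (x + h)) \<le> - A * arctan (s * x) - m x * h + m x * d / 2"
    if "\<bar>h\<bar> \<le> B" for x h
  proof -
    have "\<bar>s * h\<bar> \<le> s * B" using that s by (simp add: abs_mult)
    from arctan_tangent_lower[OF this sB, of "s * x"]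
    have "arctan (s * x) + (s * h - 2 * (s * B)\<^sup>2) / (1 + (s * x)\<^sup>2) \<le> arctan (s * (x + h))"
      by (simp add: algebra_simps)
    moreover have "2 * (s * B)\<^sup>2 = s * (d / 2)"
      using B by (simp add: s_def power2_eq_square field_simps)
    ultimately have "arctan (s * x) + (s * h - s * (d / 2)) / (1 + (s * x)\<^sup>2) \<le> arctan (s * (x + h))"
      by simp
    then have "A * (arctan (s * x) + (s * h - s * (d / 2)) / (1 + (s * x)\<^sup>2)) \<le> A * arctan (s * (x + h))"
      using A by (rule mult_left_mono)
    then show ?thesis by (simp add: m_def algebra_simps diff_divide_distrib)
  qed
  \<comment> \<open>A step that changes the sign must start within \<open>B\<close> of 0, where
    \<open>mlow\<close> applies.\<close>
  have b1: "b (x + h) \<le> b x - p * h + m x * d / 2" if "x < 0" "\<bar>h\<bar> \<le> B" for x h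
  proof (cases "x + h < 0")
    case True
    then show ?thesis using that m0[of x] assms by (simp add: b_def algebra_simps)
  next
    case False
    then have "(p - a) * (x + h) \<le> R * B" using that pa assms by (intro mult_mono) auto
    also have "\<dots> \<le> m x * d / 2" using False that by (intro mlow) auto
    finally show ?thesis using that False by (simp add: b_def algebra_simps)
  qed
  have b2: "b (x + h) \<le> b x - a * h + m x * d / 2" if "x \<ge> 0" "\<bar>h\<bar> \<le> B" for x h
  proof (cases "x + h < 0")
    case False
    then show ?thesis using that m0[of x] assms by (simp add: b_def algebra_simps)
  next
    case True
    then have "(p - a) * - (x + h) \<le> R * B" using that pa assms by (intro mult_mono) auto
    also have "\<dots> \<le> m x * d / 2" using True that by (intro mlow) auto
    finally show ?thesis using that True by (simp add: b_def algebra_simps)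
  qed
  have 1: "\<phi> (x + h) \<le> \<phi> x - (p + m x) * h + m x * d" if "x < 0" "\<bar>h\<bar> \<le> B" for x h
    using b1[OF that] arc[OF that(2), of x] by (simp add: \<phi>_def algebra_simps)
  have 2: "\<phi> (x + h) \<le> \<phi> x - (a + m x) * h + m x * d" if "x \<ge> 0" "\<bar>h\<bar> \<le> B" for x h
    using b2[OF that] arc[OF that(2), of x] by (simp add: \<phi>_def algebra_simps)
  have 3: "\<phi> (x + h) \<le> \<phi> x + ?L" if h: "\<bar>h\<bar> \<le> B" for x h
  proof -
    have aux: "- (q + m x) * h + m x * d \<le> ?L" if q: "0 \<le> q" "q \<le> R" for q
    proof -
      have "- (q + m x) * h \<le> (q + m x) * B"
        using h m0[of x] q B mult_left_mono[of "- h" B "q + m x"] by (simp add: algebra_simps)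
      also have "\<dots> \<le> (R + A * s) * B" using q mA[of x] B by (intro mult_right_mono) auto
      finally show ?thesis using mult_right_mono[OF mA[of x], of d] assms by linarith
    qed
    show ?thesis
    proof (cases "x < 0")
      case True
      then show ?thesis using 1[OF True h] aux[OF pa(1,2)] by linarith
    next
      case False
      then show ?thesis using 2[of x, OF _ h] aux[OF pa(3,4)] by linarith
    qed
  qed
  have arcb: "A * \<bar>arctan y\<bar> \<le> 2 * A" for y
  proof -
    have "\<bar>arctan y\<bar> \<le> 2" using arctan_bounded[of y] pi_less_4 by linarith
    then show ?thesis using A mult_left_mono[of "\<bar>arctan y\<bar>" 2 A] by linarith
  qed
  have arcb': "A * arctan y \<le> 2 * A" "- (2 * A) \<le> A * arctan y" for y
    using arcb[of y] A abs_mult[of A "arctan y"] by linarith+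
  have 4: "- a * y - ?K \<le> \<phi> x" if "x \<le> y" "0 \<le> y" for x y
  proof (cases "x < 0")
    case True
    have "0 \<le> - p * x" using True pa by (simp add: mult_nonneg_nonpos)
    moreover have "- a * y \<le> 0" using that pa by simp
    ultimately show ?thesis using True arcb'(1)[of "s * x"] by (simp add: \<phi>_def b_def)
  next
    case False
    have "- a * y \<le> - a * x" using that pa by (simp add: mult_left_mono)
    then show ?thesis using False arcb'(1)[of "s * x"] by (simp add: \<phi>_def b_def)
  qed
  have 5: "\<phi> x \<le> - p * x + ?K" if "x \<le> 0" for x
    using that arcb'(2)[of "s * x"] by (cases "x = 0") (auto simp: \<phi>_def b_def)
  show "\<exists>\<phi>::real \<Rightarrow> real.
       (\<forall>x<0. \<exists>m\<ge>0. \<forall>h. \<bar>h\<bar> \<le> B \<longrightarrow> \<phi> (x + h) \<le> \<phi> x - (p + m) * h + m * d) \<and>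
       (\<forall>x\<ge>0. \<exists>m\<ge>0. \<forall>h. \<bar>h\<bar> \<le> B \<longrightarrow> \<phi> (x + h) \<le> \<phi> x - (a + m) * h + m * d) \<and>
       (\<forall>x h. \<bar>h\<bar> \<le> B \<longrightarrow> \<phi> (x + h) \<le> \<phi> x + ?L) \<and>
       (\<forall>x y. x \<le> y \<longrightarrow> 0 \<le> y \<longrightarrow> - a * y - ?K \<le> \<phi> x) \<and>
       (\<forall>x\<le>0. \<phi> x \<le> - p * x + ?K)"
  proof (intro exI[of _ \<phi>] conjI allI impI)
    show "\<exists>n\<ge>0. \<forall>h. \<bar>h\<bar> \<le> B \<longrightarrow> \<phi> (x + h) \<le> \<phi> x - (p + n) * h + n * d" if "x < 0" for x
      using 1[OF that] m0[of x] by (intro exI[of _ "m x"]) simp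
    show "\<exists>n\<ge>0. \<forall>h. \<bar>h\<bar> \<le> B \<longrightarrow> \<phi> (x + h) \<le> \<phi> x - (a + n) * h + n * d" if "0 \<le> x" for x
      using 2[OF that] m0[of x] by (intro exI[of _ "m x"]) simp
  qed (use 3 4 5 in simp_all)
qed

subsection \<open>Drift of the log odds\<close>

lemma exists_ge_expectation:
  fixes f :: "'a \<Rightarrow> real"
  assumes "finite (set_pmf p)"
  shows "\<exists>a. measure_pmf.expectation p f \<le> f a"
proof (rule ccontr)
  let ?c = "measure_pmf.expectation p f"
  assume "\<nexists>a. ?c \<le> f a"
  then have less: "f a < ?c" for a by (simp add: not_le)
  have "?c = (\<Sum>a\<in>set_pmf p. f a * pmf p a)"
    using assms by (rule integral_measure_pmf_real) auto
  also have "\<dots> < (\<Sum>a\<in>set_pmf p. ?c * pmf p a)"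
    using assms set_pmf_not_empty less by (intro sum_strict_mono) (auto simp: pmf_positive)
  also have "\<dots> = ?c" using assms by (simp add: sum_distrib_left[symmetric] sum_pmf_eq_1)
  finally show False by simp
qed

lemma expectation_Pi_pmf_component:
  fixes g :: "'x::finite \<Rightarrow> real"
  assumes "finite A" "i \<in> A"
  shows "measure_pmf.expectation (Pi_pmf A dflt (\<lambda>_. P)) (\<lambda>e. g (e i)) = (\<Sum>x\<in>UNIV. pmf P x * g x)"
proof -
  have "measure_pmf.expectation (Pi_pmf A dflt (\<lambda>_. P)) (\<lambda>e. g (e i)) =
        measure_pmf.expectation (map_pmf (\<lambda>e. e i) (Pi_pmf A dflt (\<lambda>_. P))) g"
    by simp
  also have "\<dots> = measure_pmf.expectation P g" using assms by (subst Pi_pmf_component) auto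
  finally show ?thesis by (simp add: integral_measure_pmf_real[of UNIV] mult.commute)
qed

text \<open>Splitting off coordinate \<open>i\<close> of the product leaves coordinate
  \<open>j\<close> independent of it.\<close>

lemma expectation_Pi_pmf_pair:
  fixes k :: "'x::finite \<Rightarrow> 'x \<Rightarrow> real"
  assumes A: "finite A" "i \<in> A" "j \<in> A" "i \<noteq> j"
  shows "measure_pmf.expectation (Pi_pmf A dflt (\<lambda>_. P)) (\<lambda>e. k (e i) (e j)) =
         (\<Sum>x\<in>UNIV. \<Sum>x'\<in>UNIV. pmf P x * pmf P x' * k x x')"
proof -
  have Ai: "A = insert i (A - {i})" using A by auto
  let ?R = "Pi_pmf (A - {i}) dflt (\<lambda>_. P)"
  have "map_pmf (\<lambda>e. (e i, e j)) (Pi_pmf A dflt (\<lambda>_. P)) = map_pmf (\<lambda>(x, e). (x, e j)) (pair_pmf P ?R)"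
    using A by (subst Ai, subst Pi_pmf_insert) (auto simp: pmf.map_comp o_def case_prod_unfold)
  also have "\<dots> = pair_pmf P (map_pmf (\<lambda>e. e j) ?R)"
    unfolding pair_map_pmf2 by (rule arg_cong[where f = "\<lambda>h. map_pmf h _"]) auto
  also have "\<dots> = pair_pmf P P" using A by (subst Pi_pmf_component) auto
  finally have "measure_pmf.expectation (Pi_pmf A dflt (\<lambda>_. P)) (\<lambda>e. k (e i) (e j)) =
        measure_pmf.expectation (pair_pmf P P) (\<lambda>z. k (fst z) (snd z))"
    using integral_map_pmf[of "\<lambda>e. (e i, e j)" "Pi_pmf A dflt (\<lambda>_. P)" "\<lambda>z. k (fst z) (snd z)"]
    by simp
  also have "\<dots> = (\<Sum>z\<in>UNIV. k (fst z) (snd z) * pmf (pair_pmf P P) z)"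
    by (rule integral_measure_pmf_real) auto
  also have "\<dots> = (\<Sum>x\<in>UNIV. \<Sum>x'\<in>UNIV. pmf P x * pmf P x' * k x x')"
    unfolding UNIV_Times_UNIV[symmetric] sum.cartesian_product
    by (rule sum.cong) (auto simp: pmf_pair)
  finally show ?thesis .
qed

text \<open>The state \<open>\<omega>\<close> is the unnormalised posterior: \<open>\<omega> i\<close> is the joint probability of message \<open>i\<close> and
  the observed outputs.\<close>

definition others :: "nat \<Rightarrow> (nat \<Rightarrow> real) \<Rightarrow> nat \<Rightarrow> real" where
  "others M \<omega> i = (\<Sum>j\<in>{..<M}-{i}. \<omega> j)"

definition log_odds :: "nat \<Rightarrow> (nat \<Rightarrow> real) \<Rightarrow> nat \<Rightarrow> real" where
  "log_odds M \<omega> i = ln (\<omega> i / others M \<omega> i)"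

definition update :: "('x \<Rightarrow> 'y pmf) \<Rightarrow> (nat \<Rightarrow> 'x) \<Rightarrow> 'y \<Rightarrow> (nat \<Rightarrow> real) \<Rightarrow> nat \<Rightarrow> real" where
  "update W e y \<omega> = (\<lambda>i. \<omega> i * pmf (W (e i)) y)"

lemma others_pos:
  assumes "2 \<le> M" "\<forall>j<M. 0 < \<omega> j"
  shows "0 < others M \<omega> i"
proof -
  have "(if i = 0 then 1 else 0) \<in> {..<M} - {i}" using assms(1) by auto
  then show ?thesis unfolding others_def using assms(2) by (intro sum_pos) auto
qed

lemma others_eq: "i < M \<Longrightarrow> others M \<omega> i = (\<Sum>j<M. \<omega> j) - \<omega> i"
  by (simp add: others_def sum_diff1)

section \<open>Increments of the log odds over a common support\<close>

text \<open>Finite \<open>C1 W\<close> forces all rows of the channel to share one support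
  \<open>S\<close>. The log likelihood ratios on it are bounded, so the log odds move by at most
  \<open>B\<close> per step.\<close>

locale common_support =
  fixes W :: "'x::finite \<Rightarrow> 'y::finite pmf" and S :: "'y set" and B :: real
  assumes pmf_pos: "y \<in> S \<Longrightarrow> 0 < pmf (W x) y"
    and pmf_zero: "y \<notin> S \<Longrightarrow> pmf (W x) y = 0"
    and log_ratio_le: "y \<in> S \<Longrightarrow> \<bar>ln (pmf (W x) y / pmf (W x') y)\<bar> \<le> B"
begin

lemma sum_support: "(\<Sum>y\<in>S. pmf (W x) y) = 1"
proof -
  have "(\<Sum>y\<in>S. pmf (W x) y) = (\<Sum>y\<in>UNIV. pmf (W x) y)"
    by (rule sum.mono_neutral_left) (auto simp: pmf_zero)
  then show ?thesis by (simp add: sum_pmf_eq_1)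
qed

lemma pmf_le_exp: "y \<in> S \<Longrightarrow> pmf (W x) y \<le> exp B * pmf (W x') y"
proof -
  assume y: "y \<in> S"
  have "ln (pmf (W x) y / pmf (W x') y) \<le> B" using log_ratio_le[OF y, of x x'] by simp
  then have "pmf (W x) y / pmf (W x') y \<le> exp B"
    using pmf_pos[OF y] by (metis divide_pos_pos exp_le_cancel_iff exp_ln)
  then show ?thesis using pmf_pos[OF y, of x'] by (simp add: pos_divide_le_eq)
qed

definition increment :: "nat \<Rightarrow> (nat \<Rightarrow> real) \<Rightarrow> (nat \<Rightarrow> 'x) \<Rightarrow> 'y \<Rightarrow> nat \<Rightarrow> real" where
  "increment M \<omega> e y i = log_odds M (update W e y \<omega>) i - log_odds M \<omega> i"

text \<open>The mean is conditional on \<open>i\<close> being the true message.\<close>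

definition drift :: "nat \<Rightarrow> (nat \<Rightarrow> real) \<Rightarrow> (nat \<Rightarrow> 'x) \<Rightarrow> nat \<Rightarrow> real" where
  "drift M \<omega> e i = (\<Sum>y\<in>S. pmf (W (e i)) y * increment M \<omega> e y i)"

lemma update_pos: "y \<in> S \<Longrightarrow> 0 < \<omega> i \<Longrightarrow> 0 < update W e y \<omega> i"
  by (simp add: update_def pmf_pos)

context
  fixes M :: nat and \<omega> :: "nat \<Rightarrow> real"
  assumes M: "2 \<le> M" and \<omega>: "\<forall>j<M. 0 < \<omega> j"
begin

lemma others_weights_pos: "0 < others M \<omega> i"
  using others_pos[OF M, of \<omega>] \<omega> by blast

lemma others_update_pos: "y \<in> S \<Longrightarrow> 0 < others M (update W e y \<omega>) i"
  using others_pos[OF M, of "update W e y \<omega>"] \<omega> by (simp add: update_pos)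

text \<open>The weight of \<open>i\<close> cancels; what remains is the log likelihood ratio of the
  row of \<open>e i\<close> against the posterior mixture of the rows of the other messages.\<close>

lemma increment_eq:
  assumes "y \<in> S" "i < M"
  shows "increment M \<omega> e y i =
    ln (pmf (W (e i)) y) - ln (others M (update W e y \<omega>) i / others M \<omega> i)"
  using assms others_update_pos[of y e i] others_weights_pos[of i] \<omega>[rule_format, of i] pmf_pos[of y "e i"]
  unfolding increment_def log_odds_def
  by (simp add: ln_div ln_mult update_def)

text \<open>A mixture of rows differs from any single row by a factor of at most
  \<open>exp B\<close>.\<close>

lemma abs_increment_le:
  assumes y: "y \<in> S" and i: "i < M"
  shows "\<bar>increment M \<omega> e y i\<bar> \<le> B"
proof -
  let ?o = "others M \<omega> i" and ?o' = "others M (update W e y \<omega>) i" and ?p = "pmf (W (e i)) y"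
  have o: "0 < ?o" "0 < ?o'" "0 < ?p"
    using others_weights_pos others_update_pos y pmf_pos by auto
  have "?o' \<le> (\<Sum>j\<in>{..<M}-{i}. exp B * ?p * \<omega> j)"
    unfolding others_def update_def
    by (rule sum_mono) (use \<omega> pmf_le_exp[OF y] in \<open>auto simp: mult.commute intro!: mult_right_mono less_imp_le\<close>)
  also have "\<dots> = exp B * ?p * ?o" by (simp add: others_def sum_distrib_left)
  finally have 1: "?o' / ?o \<le> exp B * ?p" using o by (simp add: pos_divide_le_eq)
  have "?p * ?o = (\<Sum>j\<in>{..<M}-{i}. ?p * \<omega> j)" by (simp add: others_def sum_distrib_left)
  also have "\<dots> \<le> (\<Sum>j\<in>{..<M}-{i}. exp B * (\<omega> j * pmf (W (e j)) y))"
  proof (rule sum_mono)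
    fix j assume "j \<in> {..<M} - {i}"
    then show "?p * \<omega> j \<le> exp B * (\<omega> j * pmf (W (e j)) y)"
      using mult_right_mono[OF pmf_le_exp[OF y, of "e i" "e j"], of "\<omega> j"] \<omega>[rule_format, of j]
      by (simp add: mult_ac)
  qed
  also have "\<dots> = exp B * ?o'" by (simp add: others_def update_def sum_distrib_left)
  finally have 2: "?p \<le> exp B * (?o' / ?o)" using o by (simp add: pos_le_divide_eq)
  have "0 < ?o' / ?o" using o by simp
  moreover from this have "ln ?p \<le> ln (exp B * (?o' / ?o))" "ln (?o' / ?o) \<le> ln (exp B * ?p)"
    using 1 2 o by (subst ln_le_cancel_iff; simp)+
  ultimately have "ln ?p \<le> B + ln (?o' / ?o)" "ln (?o' / ?o) \<le> B + ln ?p"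
    using o(3) by (simp_all only: ln_mult_pos exp_gt_zero ln_exp)
  then show ?thesis unfolding increment_eq[OF y i] by linarith
qed

text \<open>Random coding: with inputs drawn independently from \<open>P\<close>, the expected drift
  of every message is at least \<open>mutual_info P W\<close>. By linearity this passes to any
  nonnegative combination, and some outcome of the draw reaches the mean.\<close>

lemma exists_encoder:
  assumes \<alpha>: "\<And>i. i < M \<Longrightarrow> 0 \<le> \<alpha> i"
  shows "\<exists>e. mutual_info P W * (\<Sum>i<M. \<alpha> i) \<le> (\<Sum>i<M. \<alpha> i * drift M \<omega> e i)"
proof -
  define q where "q y = (\<Sum>x\<in>UNIV. pmf P x * pmf (W x) y)" for y
  define h where "h x = (\<Sum>y\<in>S. pmf (W x) y * ln (pmf (W x) y / q y))" for x
  define k where "k x x' = (\<Sum>y\<in>S. pmf (W x) y * pmf (W x') y / q y)" for x x'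
  have q_pos: "0 < q y" if "y \<in> S" for y
  proof -
    obtain x where "x \<in> set_pmf P" using set_pmf_not_empty by fast
    then have "0 < pmf P x * pmf (W x) y" using pmf_pos[OF that] by (simp add: pmf_positive)
    also have "\<dots> \<le> q y" unfolding q_def by (rule member_le_sum) auto
    finally show ?thesis .
  qed
  have I: "mutual_info P W = (\<Sum>x\<in>UNIV. pmf P x * h x)"
  proof -
    have "(\<Sum>y\<in>UNIV. if pmf P x * pmf (W x) y = 0 then 0
            else pmf P x * pmf (W x) y * ln (pmf (W x) y / q y)) = pmf P x * h x" for x
      unfolding h_def sum_distrib_left
      by (rule sum.mono_neutral_cong_right) (use pmf_zero in auto)
    then show ?thesis by (simp only: mutual_info_def q_def[symmetric] Let_def)
  qed
  \<comment> \<open>Averaging over two independent inputs turns \<open>k\<close> into the sum of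
    \<open>q y * q y / q y\<close>, the total mass of \<open>q\<close>.\<close>
  have k1: "(\<Sum>x\<in>UNIV. \<Sum>x'\<in>UNIV. pmf P x * pmf P x' * k x x') = 1"
  proof -
    have "(\<Sum>x\<in>UNIV. \<Sum>x'\<in>UNIV. pmf P x * pmf P x' * k x x') =
       (\<Sum>x\<in>UNIV. \<Sum>x'\<in>UNIV. \<Sum>y\<in>S. (pmf P x * pmf (W x) y) * (pmf P x' * pmf (W x') y) / q y)"
      by (simp add: k_def sum_distrib_left mult_ac)
    also have "\<dots> = (\<Sum>y\<in>S. \<Sum>x\<in>UNIV. \<Sum>x'\<in>UNIV. (pmf P x * pmf (W x) y) * (pmf P x' * pmf (W x') y) / q y)"
      by (subst sum.swap[of _ S], subst sum.swap[of _ S]) (rule refl)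
    also have "\<dots> = (\<Sum>y\<in>S. q y * q y / q y)"
      by (simp add: q_def sum_product sum_divide_distrib)
    also have "\<dots> = (\<Sum>y\<in>S. q y)" using q_pos by (intro sum.cong) auto
    also have "\<dots> = (\<Sum>x\<in>UNIV. pmf P x * (\<Sum>y\<in>S. pmf (W x) y))"
      unfolding q_def by (subst sum.swap) (simp add: sum_distrib_left)
    also have "\<dots> = 1" by (simp add: sum_support sum_pmf_eq_1)
    finally show ?thesis .
  qed
  define \<beta> where "\<beta> i j = \<omega> j / others M \<omega> i" for i j
  have \<beta>1: "(\<Sum>j\<in>{..<M}-{i}. \<beta> i j) = 1" for i
    using others_weights_pos[of i] by (simp add: \<beta>_def others_def sum_divide_distrib[symmetric])
  \<comment> \<open>The drift with the logarithm of the mixture replaced by its tangent at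
    \<open>q\<close>. In the mean the \<open>k\<close> terms cancel the added 1, and
    \<open>h\<close> gives the mutual information.\<close>
  define g where "g e i = h (e i) + 1 - (\<Sum>j\<in>{..<M}-{i}. \<beta> i j * k (e i) (e j))" for e i
  have drift_ge: "g e i \<le> drift M \<omega> e i" if i: "i < M" for e i
  proof -
    have "g e i = (\<Sum>y\<in>S. pmf (W (e i)) y * (ln (pmf (W (e i)) y / q y) + 1
                - others M (update W e y \<omega>) i / others M \<omega> i / q y))"
    proof -
      have "(\<Sum>j\<in>{..<M}-{i}. \<beta> i j * k (e i) (e j)) =
        (\<Sum>y\<in>S. \<Sum>j\<in>{..<M}-{i}. \<beta> i j * (pmf (W (e i)) y * pmf (W (e j)) y / q y))"
        unfolding k_def sum_distrib_left by (rule sum.swap)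
      also have "\<dots> = (\<Sum>y\<in>S. pmf (W (e i)) y * (others M (update W e y \<omega>) i / others M \<omega> i / q y))"
        by (simp add: others_def update_def \<beta>_def sum_distrib_left sum_divide_distrib mult_ac)
      finally show ?thesis
        by (simp add: g_def h_def distrib_left right_diff_distrib sum.distrib sum_subtractf sum_support)
    qed
    also have "\<dots> \<le> drift M \<omega> e i" unfolding drift_def
    proof (intro sum_mono mult_left_mono pmf_nonneg)
      fix y assume y: "y \<in> S"
      let ?Q = "others M (update W e y \<omega>) i / others M \<omega> i"
      have Q: "0 < ?Q" using others_weights_pos others_update_pos[OF y] by simp
      \<comment> \<open>The tangent bound makes the drift bilinear in the encoder, so only pairwise independence is needed.\<close>
      have "ln (?Q / q y) \<le> ?Q / q y - 1" using divide_pos_pos[OF Q q_pos[OF y]] by (rule ln_le_minus_one)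
      moreover have "ln (?Q / q y) = ln ?Q - ln (q y)" using Q q_pos[OF y] by (rule ln_divide_pos)
      moreover have "ln (pmf (W (e i)) y / q y) = ln (pmf (W (e i)) y) - ln (q y)"
        using pmf_pos[OF y] q_pos[OF y] by (rule ln_divide_pos)
      ultimately show "ln (pmf (W (e i)) y / q y) + 1 - ?Q / q y \<le> increment M \<omega> e y i"
        unfolding increment_eq[OF y i] by linarith
    qed
    finally show ?thesis .
  qed
  let ?\<mu> = "Pi_pmf {..<M} undefined (\<lambda>_. P)"
  have fin: "finite (set_pmf ?\<mu>)"
    by (rule finite_subset[OF set_Pi_pmf_subset']) (auto intro: finite_PiE_dflt)
  note int = integrable_measure_pmf_finite[OF fin]
  have "measure_pmf.expectation ?\<mu> (\<lambda>e. g e i) = mutual_info P W" if i: "i < M" for i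
  proof -
    have "measure_pmf.expectation ?\<mu> (\<lambda>e. g e i) =
      measure_pmf.expectation ?\<mu> (\<lambda>e. h (e i)) + 1
       - (\<Sum>j\<in>{..<M}-{i}. \<beta> i j * measure_pmf.expectation ?\<mu> (\<lambda>e. k (e i) (e j)))"
      unfolding g_def by (simp add: int)
    also have "(\<Sum>j\<in>{..<M}-{i}. \<beta> i j * measure_pmf.expectation ?\<mu> (\<lambda>e. k (e i) (e j))) =
      (\<Sum>j\<in>{..<M}-{i}. \<beta> i j)"
      using i by (intro sum.cong) (auto simp: expectation_Pi_pmf_pair k1)
    finally show ?thesis using i by (simp add: \<beta>1 expectation_Pi_pmf_component I)
  qed
  then have "measure_pmf.expectation ?\<mu> (\<lambda>e. \<Sum>i<M. \<alpha> i * g e i) = mutual_info P W * (\<Sum>i<M. \<alpha> i)"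
    by (simp add: int sum_distrib_left mult.commute)
  then obtain e where "mutual_info P W * (\<Sum>i<M. \<alpha> i) \<le> (\<Sum>i<M. \<alpha> i * g e i)"
    using exists_ge_expectation[OF fin, of "\<lambda>e. \<Sum>i<M. \<alpha> i * g e i"] by auto
  also have "\<dots> \<le> (\<Sum>i<M. \<alpha> i * drift M \<omega> e i)"
    using \<alpha> drift_ge by (intro sum_mono mult_left_mono) auto
  finally show ?thesis by blast
qed

end

end

section \<open>One-step decrease of the potential\<close>

context common_support
begin

context
  fixes M :: nat and \<omega> :: "nat \<Rightarrow> real"
  assumes M: "2 \<le> M" and \<omega>: "\<forall>j<M. 0 < \<omega> j"
begin

text \<open>Exchanging the sums conditions on the true message, so that each message is averaged
  under its own output law.\<close>

lemma sum_update_potential: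
  "(\<Sum>y\<in>S. \<Sum>i<M. update W e y \<omega> i * v (log_odds M (update W e y \<omega>) i)) =
   (\<Sum>i<M. \<omega> i * (\<Sum>y\<in>S. pmf (W (e i)) y * v (log_odds M \<omega> i + increment M \<omega> e y i)))"
  by (subst sum.swap) (simp add: sum_distrib_left update_def increment_def mult_ac)

lemma mean_potential_le:
  assumes i: "i < M"
    and v: "\<And>h. \<bar>h\<bar> \<le> B \<Longrightarrow> v (log_odds M \<omega> i + h) \<le> b - r * h"
  shows "(\<Sum>y\<in>S. pmf (W (e i)) y * v (log_odds M \<omega> i + increment M \<omega> e y i)) \<le> b - r * drift M \<omega> e i"
proof -
  have "(\<Sum>y\<in>S. pmf (W (e i)) y * v (log_odds M \<omega> i + increment M \<omega> e y i)) \<le>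
        (\<Sum>y\<in>S. pmf (W (e i)) y * (b - r * increment M \<omega> e y i))"
    using v abs_increment_le[OF M \<omega> _ i] by (intro sum_mono mult_left_mono) auto
  also have "\<dots> = b - r * drift M \<omega> e i"
    unfolding drift_def
    by (simp add: right_diff_distrib sum_subtractf sum_distrib_left sum_support
        sum_distrib_right[symmetric] mult.left_commute)
  finally show ?thesis .
qed

text \<open>All competitors send \<open>x1\<close>, so their mixture is the row of \<open>x1\<close>
  whatever the posterior.\<close>

lemma increment_two_point:
  assumes y: "y \<in> S" and i: "i < M"
  shows "increment M \<omega> (\<lambda>j. if j = i then x0 else x1) y i = ln (pmf (W x0) y / pmf (W x1) y)"
proof -
  let ?e = "\<lambda>j. if j = i then x0 else x1"
  have "others M (update W ?e y \<omega>) i = others M \<omega> i * pmf (W x1) y"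
    unfolding others_def sum_distrib_right by (rule sum.cong) (auto simp: update_def)
  then show ?thesis
    using increment_eq[OF M \<omega> y i, of ?e] others_weights_pos[OF M \<omega>, of i] pmf_pos[OF y]
    by (simp add: ln_divide_pos)
qed

text \<open>The subtracted total weight is one unit of time, charged to the current history with its
  probability. Below level \<open>l\<close> the random encoder supplies the drift; above it the
  leading message is set against all others, and the excess of \<open>a * D\<close> over 1
  compensates for the losses of the others.\<close>

lemma potential_decrease:
  fixes \<phi> :: "real \<Rightarrow> real" and x0 x1 :: 'x
  defines "D \<equiv> \<Sum>y\<in>S. pmf (W x0) y * ln (pmf (W x0) y / pmf (W x1) y)"
  assumes below: "\<forall>x<0. \<exists>m\<ge>0. \<forall>h. \<bar>h\<bar> \<le> B \<longrightarrow> \<phi> (x + h) \<le> \<phi> x - (p + m) * h + m * d"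
    and above: "\<forall>x\<ge>0. \<exists>m\<ge>0. \<forall>h. \<bar>h\<bar> \<le> B \<longrightarrow> \<phi> (x + h) \<le> \<phi> x - (a + m) * h + m * d"
    and lip: "\<forall>x h. \<bar>h\<bar> \<le> B \<longrightarrow> \<phi> (x + h) \<le> \<phi> x + L"
    and p: "0 \<le> p" "1 \<le> p * mutual_info P W" and d: "d \<le> mutual_info P W" "d \<le> D"
    and L: "0 \<le> L"
    and a: "1 + (1 + L) * exp (- l) \<le> a * D"
    and v: "\<And>x. v x = v0 + \<phi> (x - l)"
  shows "\<exists>e. (\<Sum>y\<in>S. \<Sum>i<M. update W e y \<omega> i * v (log_odds M (update W e y \<omega>) i))
           \<le> (\<Sum>i<M. \<omega> i * v (log_odds M \<omega> i)) - (\<Sum>i<M. \<omega> i)"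
proof (cases "\<forall>i<M. log_odds M \<omega> i < l")
  case True
  let ?I = "mutual_info P W"
  have m_ex: "\<forall>i. \<exists>m. i < M \<longrightarrow> 0 \<le> m \<and> (\<forall>h. \<bar>h\<bar> \<le> B \<longrightarrow>
      v (log_odds M \<omega> i + h) \<le> v (log_odds M \<omega> i) - (p + m) * h + m * d)"
  proof
    fix i
    show "\<exists>m. i < M \<longrightarrow> 0 \<le> m \<and> (\<forall>h. \<bar>h\<bar> \<le> B \<longrightarrow>
      v (log_odds M \<omega> i + h) \<le> v (log_odds M \<omega> i) - (p + m) * h + m * d)"
      using below[rule_format, of "log_odds M \<omega> i - l"] True v by (cases "i < M") (auto simp: algebra_simps)
  qed
  obtain m where m: "\<And>i. i < M \<Longrightarrow> 0 \<le> m i" and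
    vm: "\<And>i h. i < M \<Longrightarrow> \<bar>h\<bar> \<le> B \<Longrightarrow>
      v (log_odds M \<omega> i + h) \<le> v (log_odds M \<omega> i) + m i * d - (p + m i) * h"
  proof -
    obtain m where "\<forall>i. i < M \<longrightarrow> 0 \<le> m i \<and> (\<forall>h. \<bar>h\<bar> \<le> B \<longrightarrow>
      v (log_odds M \<omega> i + h) \<le> v (log_odds M \<omega> i) - (p + m i) * h + m i * d)"
      using choice[OF m_ex] by blast
    then show ?thesis using that[of m] by (auto simp: algebra_simps)
  qed
  \<comment> \<open>The slope \<open>p + m i\<close> varies with the message, so it goes into the
    weights handed to \<open>exists_encoder\<close>.\<close>
  have "\<exists>e. ?I * (\<Sum>i<M. \<omega> i * (p + m i)) \<le> (\<Sum>i<M. \<omega> i * (p + m i) * drift M \<omega> e i)"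
    by (rule exists_encoder[OF M \<omega>]) (use m p \<omega> in \<open>simp add: less_imp_le\<close>)
  then obtain e where e: "?I * (\<Sum>i<M. \<omega> i * (p + m i)) \<le> (\<Sum>i<M. \<omega> i * (p + m i) * drift M \<omega> e i)"
    by blast
  have "(\<Sum>y\<in>S. \<Sum>i<M. update W e y \<omega> i * v (log_odds M (update W e y \<omega>) i)) \<le>
    (\<Sum>i<M. \<omega> i * (v (log_odds M \<omega> i) + m i * d - (p + m i) * drift M \<omega> e i))"
    unfolding sum_update_potential
    by (intro sum_mono mult_left_mono mean_potential_le vm) (use \<omega> in \<open>auto intro: less_imp_le\<close>)
  also have "\<dots> = (\<Sum>i<M. \<omega> i * v (log_odds M \<omega> i)) + ((\<Sum>i<M. \<omega> i * (m i * d))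
      - (\<Sum>i<M. \<omega> i * (p + m i) * drift M \<omega> e i))"
    unfolding sum.distrib[symmetric] sum_subtractf[symmetric]
    by (intro sum.cong refl) (simp add: algebra_simps)
  also have "\<dots> \<le> (\<Sum>i<M. \<omega> i * v (log_odds M \<omega> i)) + ((\<Sum>i<M. \<omega> i * (m i * d))
      - ?I * (\<Sum>i<M. \<omega> i * (p + m i)))"
    using e by simp
  also have "(\<Sum>i<M. \<omega> i * (m i * d)) - ?I * (\<Sum>i<M. \<omega> i * (p + m i)) =
      (\<Sum>i<M. \<omega> i * (m i * (d - ?I) - p * ?I))"
    unfolding sum_distrib_left sum_subtractf[symmetric]
    by (intro sum.cong refl) (simp add: algebra_simps)
  also have "\<dots> \<le> (\<Sum>i<M. \<omega> i * (- 1))"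
  proof (intro sum_mono mult_left_mono)
    fix i assume i: "i \<in> {..<M}"
    \<comment> \<open>A drift of at least \<open>d\<close> repays the curvature term
      \<open>m i * d\<close>, while slope \<open>p\<close> turns the drift into a full unit of
      time.\<close>
    have "m i * (d - ?I) \<le> 0" using m i d by (intro mult_nonneg_nonpos) auto
    then show "m i * (d - ?I) - p * ?I \<le> - 1" using p by linarith
    show "0 \<le> \<omega> i" using \<omega>[rule_format, of i] i by simp
  qed
  finally show ?thesis by (intro exI[of _ e]) (simp add: sum_negf)
next
  case False
  then obtain i where i: "i < M" "l \<le> log_odds M \<omega> i" by force
  let ?e = "\<lambda>j. if j = i then x0 else x1"
  let ?o = "others M \<omega> i"
  obtain m where m: "0 \<le> m" "\<And>h. \<bar>h\<bar> \<le> B \<Longrightarrow>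
      v (log_odds M \<omega> i + h) \<le> v (log_odds M \<omega> i) + m * d - (a + m) * h"
    using above[rule_format, of "log_odds M \<omega> i - l"] i v by (auto simp: algebra_simps)
  have D: "drift M \<omega> ?e i = D"
    unfolding drift_def D_def by (rule sum.cong) (auto simp: increment_two_point i)
  have top: "(\<Sum>y\<in>S. pmf (W (?e i)) y * v (log_odds M \<omega> i + increment M \<omega> ?e y i))
      \<le> v (log_odds M \<omega> i) - a * D"
  proof -
    have "m * d \<le> m * D" using m(1) d by (intro mult_left_mono) auto
    then show ?thesis
      using mean_potential_le[OF i(1) m(2), of ?e] unfolding D by (simp add: algebra_simps)
  qed
  \<comment> \<open>No control of the drift of the other messages is available, so slope 0 and the
    crude bound \<open>L\<close> are used.\<close>
  have rest: "(\<Sum>y\<in>S. pmf (W (?e j)) y * v (log_odds M \<omega> j + increment M \<omega> ?e y j))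
      \<le> v (log_odds M \<omega> j) + L" if "j < M" for j
    using mean_potential_le[OF that, of v "v (log_odds M \<omega> j) + L" 0 ?e]
      lip[rule_format, of _ "log_odds M \<omega> j - l"] by (simp add: v algebra_simps)
  have o: "0 < ?o" using others_weights_pos[OF M \<omega>] .
  have "l \<le> ln (\<omega> i / ?o)" using i(2) by (simp add: log_odds_def)
  then have "exp l \<le> \<omega> i / ?o" using o \<omega>[rule_format, OF i(1)] by (metis divide_pos_pos exp_le_cancel_iff exp_ln)
  then have oi: "?o \<le> exp (- l) * \<omega> i" using o by (simp add: exp_minus field_simps)
  have split: "(\<Sum>j<M. f j) = f i + (\<Sum>j\<in>{..<M}-{i}. f j)" for f :: "nat \<Rightarrow> real"
    using i by (simp add: sum.remove)
  have "(\<Sum>y\<in>S. \<Sum>i<M. update W ?e y \<omega> i * v (log_odds M (update W ?e y \<omega>) i)) \<le>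
     \<omega> i * (v (log_odds M \<omega> i) - a * D) + (\<Sum>j\<in>{..<M}-{i}. \<omega> j * (v (log_odds M \<omega> j) + L))"
    unfolding sum_update_potential
    by (subst split, intro add_mono sum_mono mult_left_mono top rest)
      (use \<omega> i in \<open>auto intro: less_imp_le\<close>)
  also have "\<dots> = (\<Sum>i<M. \<omega> i * v (log_odds M \<omega> i)) - \<omega> i * (a * D) + L * ?o"
    by (subst split) (simp add: others_def sum_distrib_left distrib_left sum.distrib algebra_simps)
  also have "\<dots> \<le> (\<Sum>i<M. \<omega> i * v (log_odds M \<omega> i)) - (\<Sum>i<M. \<omega> i)"
  proof -
    \<comment> \<open>The others cost \<open>L\<close> plus their own unit of time, and by
      \<open>oi\<close> their mass is at most \<open>exp (- l)\<close> times that of the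
      leader.\<close>
    have "\<omega> i * (1 + (1 + L) * exp (- l)) \<le> \<omega> i * (a * D)"
      using a \<omega>[rule_format, OF i(1)] by (intro mult_left_mono) auto
    moreover have "(1 + L) * ?o \<le> (1 + L) * (exp (- l) * \<omega> i)"
      using L oi by (intro mult_left_mono) auto
    moreover have "(\<Sum>i<M. \<omega> i) = \<omega> i + ?o" by (subst split) (simp add: others_def)
    ultimately show ?thesis by (simp add: algebra_simps)
  qed
  finally show ?thesis by blast
qed

end

end

subsection \<open>Feedback strategies driven by the posterior\<close>

text \<open>Since \<open>E\<close> sees the past only through this vector, transmitter and receiver
  can both compute it from the outputs.\<close>

definition weights ::
  "('x \<Rightarrow> 'y pmf) \<Rightarrow> nat \<Rightarrow> ((nat \<Rightarrow> real) \<Rightarrow> nat \<Rightarrow> 'x) \<Rightarrow> 'y list \<Rightarrow> nat \<Rightarrow> real" where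
  "weights W M E = foldl (\<lambda>\<omega> y. update W (E \<omega>) y \<omega>) (\<lambda>_. 1 / real M)"

lemma weights_Nil [simp]: "weights W M E [] = (\<lambda>_. 1 / real M)"
  and weights_snoc [simp]:
    "weights W M E (ys @ [y]) = update W (E (weights W M E ys)) y (weights W M E ys)"
  by (simp_all add: weights_def)

text \<open>The factor \<open>real M\<close> removes the uniform prior, as \<open>path_prob\<close>
  is conditional on the message.\<close>

lemma path_prob_eq_weights:
  assumes "1 \<le> M"
  shows "path_prob W (\<lambda>t u w ys. E (weights W M E ys) w) u w ys = real M * weights W M E ys w"
proof (induction ys rule: rev_induct)
  case Nil
  then show ?case using assms by (simp add: path_prob_def)
next
  case (snoc y ys)
  have "path_prob W (\<lambda>t u w ys. E (weights W M E ys) w) u w (ys @ [y]) =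
    path_prob W (\<lambda>t u w ys. E (weights W M E ys) w) u w ys * pmf (W (E (weights W M E ys) w)) y"
    by (simp add: path_prob_def nth_append)
  then show ?case using snoc by (simp add: update_def)
qed

lemma not_stopped_snoc:
  "not_stopped stop u (ys @ [y]) \<longleftrightarrow> not_stopped stop u ys \<and> \<not> stop u (ys @ [y])"
  by (auto simp: not_stopped_def le_Suc_eq)

lemma stops_at_snoc:
  "stops_at stop u (ys @ [y]) \<longleftrightarrow> not_stopped stop u ys \<and> stop u (ys @ [y])"
  by (auto simp: not_stopped_def stops_at_def less_Suc_eq_le)

lemma sum_lists_0: "(\<Sum>ys\<in>{ys. length ys = 0}. h ys) = h []"
  by simp

lemma sum_lists_Suc:
  fixes h :: "'y::finite list \<Rightarrow> 'a::comm_monoid_add"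
  shows "(\<Sum>ys\<in>{ys. length ys = Suc t}. h ys) = (\<Sum>ys\<in>{ys. length ys = t}. \<Sum>y\<in>UNIV. h (ys @ [y]))"
proof -
  have "{ys::'y list. length ys = Suc t} = (\<lambda>(ys, y). ys @ [y]) ` ({ys. length ys = t} \<times> UNIV)"
    by (auto simp: length_Suc_conv_rev image_iff)
  moreover have "inj_on (\<lambda>(ys, y). ys @ [y]) ({ys::'y list. length ys = t} \<times> UNIV)"
    by (auto simp: inj_on_def)
  ultimately show ?thesis
    by (simp add: sum.reindex sum.cartesian_product case_prod_unfold)
qed

text \<open>\<open>G\<close> is the cost still to be paid, where a unit of time costs 1 and an error costs \<open>c\<close>.\<close>

locale posterior_strategy =
  fixes W :: "'x \<Rightarrow> 'y::finite pmf" and M :: nat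
    and E :: "(nat \<Rightarrow> real) \<Rightarrow> nat \<Rightarrow> 'x" and halted :: "(nat \<Rightarrow> real) \<Rightarrow> bool"
    and guess :: "(nat \<Rightarrow> real) \<Rightarrow> nat" and Inv :: "(nat \<Rightarrow> real) \<Rightarrow> bool"
    and G :: "(nat \<Rightarrow> real) \<Rightarrow> real" and c \<eta> :: real
  assumes M: "1 \<le> M"
    and Inv_init: "Inv (\<lambda>_. 1 / real M)"
    and Inv_update: "Inv \<omega> \<Longrightarrow> Inv (update W (E \<omega>) y \<omega>)"
    and Inv_nonneg: "Inv \<omega> \<Longrightarrow> i < M \<Longrightarrow> 0 \<le> \<omega> i"
    and guess: "guess \<omega> < M"
    and step: "Inv \<omega> \<Longrightarrow> \<not> halted \<omega> \<Longrightarrow>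
      (\<Sum>y\<in>UNIV. G (update W (E \<omega>) y \<omega>)) \<le> G \<omega> - (\<Sum>i<M. \<omega> i)"
    and G_nonneg: "Inv \<omega> \<Longrightarrow> 0 \<le> G \<omega>"
    and stop_cost: "Inv \<omega> \<Longrightarrow> halted \<omega> \<Longrightarrow> c * ((\<Sum>i<M. \<omega> i) - \<omega> (guess \<omega>)) \<le> G \<omega>"
    and stop_correct: "Inv \<omega> \<Longrightarrow> halted \<omega> \<Longrightarrow> (1 - \<eta>) * (\<Sum>i<M. \<omega> i) \<le> \<omega> (guess \<omega>)"
begin

abbreviation "wt \<equiv> weights W M E"

definition total :: "'y list \<Rightarrow> real" where
  "total ys = (\<Sum>i<M. wt ys i)"

text \<open>The value \<open>u = 0\<close> runs the strategy and any other value stops at time 0;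
  the common randomness thereby trades time for error.\<close>

definition stop :: "nat \<Rightarrow> 'y list \<Rightarrow> bool" where
  "stop u ys \<longleftrightarrow> u \<noteq> 0 \<or> halted (wt ys)"

text \<open>Given \<open>u = 0\<close>, this and the next two are the probabilities of
  \<open>tau > t\<close>, of \<open>tau = t\<close>, and of \<open>tau = t\<close> with a correct
  guess.\<close>

definition prob_running :: "nat \<Rightarrow> real" where
  "prob_running t = (\<Sum>ys\<in>{ys. length ys = t}. if not_stopped stop 0 ys then total ys else 0)"

definition prob_halting :: "nat \<Rightarrow> real" where
  "prob_halting t = (\<Sum>ys\<in>{ys. length ys = t}. if stops_at stop 0 ys then total ys else 0)"

definition prob_correct :: "nat \<Rightarrow> real" where
  "prob_correct t = (\<Sum>ys\<in>{ys. length ys = t}. if stops_at stop 0 ys then wt ys (guess (wt ys)) else 0)"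

definition expected_cost :: "nat \<Rightarrow> real" where
  "expected_cost t = (\<Sum>ys\<in>{ys. length ys = t}. if not_stopped stop 0 ys then G (wt ys) else 0)"

section \<open>Time and error paid along the strategy\<close>

lemma Inv_weights: "Inv (wt ys)"
  by (induction ys rule: rev_induct) (simp_all add: Inv_init Inv_update)

lemma total_nonneg: "0 \<le> total ys"
  unfolding total_def using Inv_nonneg[OF Inv_weights] by (intro sum_nonneg) auto

lemma total_snoc: "(\<Sum>y\<in>UNIV. total (ys @ [y])) = total ys"
  unfolding total_def
  by (subst sum.swap) (simp add: update_def sum_distrib_left[symmetric] sum_pmf_eq_1)

lemma prob_running_nonneg: "0 \<le> prob_running t" and expected_cost_nonneg: "0 \<le> expected_cost t"
  and prob_correct_nonneg: "0 \<le> prob_correct t"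
  unfolding prob_running_def expected_cost_def prob_correct_def
  using total_nonneg G_nonneg[OF Inv_weights] Inv_nonneg[OF Inv_weights guess]
  by (auto intro!: sum_nonneg)

lemma prob_correct_le_prob_halting: "prob_correct t \<le> prob_halting t"
  unfolding prob_correct_def prob_halting_def total_def
  using guess Inv_nonneg[OF Inv_weights]
  by (intro sum_mono) (auto intro!: member_le_sum)

lemma prob_halting_le_prob_correct: "(1 - \<eta>) * prob_halting t \<le> prob_correct t"
  unfolding prob_correct_def prob_halting_def total_def sum_distrib_left
  using stop_correct[OF Inv_weights] by (intro sum_mono) (auto simp: stops_at_def stop_def)

lemma prob_halting_0: "prob_halting 0 = 1 - prob_running 0"
  using M unfolding prob_halting_def prob_running_def sum_lists_0
  by (simp add: stops_at_def not_stopped_def total_def)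

lemma prob_halting_Suc: "prob_halting (Suc t) = prob_running t - prob_running (Suc t)"
proof -
  have "prob_halting (Suc t) + prob_running (Suc t) =
    (\<Sum>ys\<in>{ys. length ys = t}. \<Sum>y\<in>UNIV. if not_stopped stop 0 ys then total (ys @ [y]) else 0)"
    unfolding prob_halting_def prob_running_def sum_lists_Suc sum.distrib[symmetric]
    by (intro sum.cong refl) (auto simp: not_stopped_snoc stops_at_snoc)
  also have "\<dots> = prob_running t"
    unfolding prob_running_def by (intro sum.cong refl) (auto simp: total_snoc)
  finally show ?thesis by simp
qed

lemma expected_cost_0: "expected_cost 0 + c * (prob_halting 0 - prob_correct 0) \<le> G (\<lambda>_. 1 / real M)"
  using stop_cost[OF Inv_init] unfolding expected_cost_def prob_halting_def prob_correct_def sum_lists_0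
  by (auto simp: stops_at_def not_stopped_def total_def stop_def)

text \<open>A supermartingale step: \<open>step\<close> pays for one unit of time on every running
  history, and a history that halts exchanges its \<open>G\<close> for the cost of its error by
  \<open>stop_cost\<close>.\<close>

lemma expected_cost_Suc: "expected_cost (Suc t) + c * (prob_halting (Suc t) - prob_correct (Suc t)) \<le> expected_cost t - prob_running t"
proof -
  have "expected_cost (Suc t) + c * (prob_halting (Suc t) - prob_correct (Suc t)) =
    (\<Sum>ys\<in>{ys. length ys = t}. \<Sum>y\<in>UNIV.
      if not_stopped stop 0 ys then
        if halted (wt (ys @ [y])) then c * (total (ys @ [y]) - wt (ys @ [y]) (guess (wt (ys @ [y]))))
        else G (wt (ys @ [y])) else 0)"
    unfolding prob_halting_def expected_cost_def prob_correct_def sum_lists_Suc sum.distrib[symmetric]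
      sum_subtractf[symmetric] sum_distrib_left
    by (intro sum.cong refl) (auto simp: not_stopped_snoc stops_at_snoc stop_def)
  also have "\<dots> \<le> (\<Sum>ys\<in>{ys. length ys = t}. \<Sum>y\<in>UNIV.
      if not_stopped stop 0 ys then G (wt (ys @ [y])) else 0)"
    using stop_cost[OF Inv_weights, of "_ @ [_]"] by (intro sum_mono) (auto simp: total_def)
  also have "\<dots> \<le> (\<Sum>ys\<in>{ys. length ys = t}.
      if not_stopped stop 0 ys then G (wt ys) - total ys else 0)"
  proof (intro sum_mono)
    fix ys
    have "\<not> halted (wt ys)" if "not_stopped stop 0 ys"
      using that by (auto simp: not_stopped_def stop_def)
    then show "(\<Sum>y\<in>UNIV. if not_stopped stop 0 ys then G (wt (ys @ [y])) else 0)
        \<le> (if not_stopped stop 0 ys then G (wt ys) - total ys else 0)"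
      using step[OF Inv_weights] by (simp add: total_def)
  qed
  also have "\<dots> = expected_cost t - prob_running t"
    unfolding expected_cost_def prob_running_def sum_subtractf[symmetric] by (intro sum.cong) auto
  finally show ?thesis .
qed

text \<open>Telescoping plays the part of optional stopping.\<close>

lemma cost_partial:
  "expected_cost T + (\<Sum>t<T. prob_running t) + c * (\<Sum>t\<le>T. prob_halting t - prob_correct t) \<le> G (\<lambda>_. 1 / real M)"
proof (induction T)
  case 0
  then show ?case using expected_cost_0 by simp
next
  case (Suc T)
  then show ?case using expected_cost_Suc[of T] by (simp add: algebra_simps)
qed

lemma sum_prob_halting: "(\<Sum>t\<le>T. prob_halting t) = 1 - prob_running T"
  by (induction T) (simp_all add: prob_halting_0 prob_halting_Suc)

context
  assumes c: "0 \<le> c"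
begin

lemma summable_prob_running: "summable prob_running"
proof (rule summableI_nonneg_bounded[OF prob_running_nonneg])
  fix T
  have "0 \<le> c * (\<Sum>t\<le>T. prob_halting t - prob_correct t)"
    using c prob_correct_le_prob_halting by (intro mult_nonneg_nonneg sum_nonneg) auto
  then show "(\<Sum>t<T. prob_running t) \<le> G (\<lambda>_. 1 / real M)"
    using cost_partial[of T] expected_cost_nonneg[of T] by linarith
qed

text \<open>The expected time is finite, so \<open>prob_running\<close> tends to 0 and the strategy
  halts almost surely.\<close>

lemma prob_halting_sums: "prob_halting sums 1"
proof -
  have "(\<lambda>T. 1 - prob_running T) \<longlonglongrightarrow> 1 - 0"
    by (intro tendsto_intros summable_LIMSEQ_zero summable_prob_running)
  then show ?thesis unfolding sums_def_le sum_prob_halting by simp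
qed

lemma summable_prob_correct: "summable prob_correct"
  by (rule summable_comparison_test'[OF sums_summable[OF prob_halting_sums], of 0])
    (use prob_correct_nonneg prob_correct_le_prob_halting in auto)

lemma prob_correct_ge: "1 - \<eta> \<le> suminf prob_correct"
proof -
  have "(1 - \<eta>) * 1 \<le> suminf prob_correct"
    using sums_mult[OF prob_halting_sums, of "1 - \<eta>"] summable_sums[OF summable_prob_correct] prob_halting_le_prob_correct
    by (rule sums_le[rotated])
  then show ?thesis by simp
qed

lemma cost_le: "suminf prob_running + c * (1 - suminf prob_correct) \<le> G (\<lambda>_. 1 / real M)"
proof (rule LIMSEQ_le_const2)
  have "(\<lambda>T. \<Sum>t\<le>T. prob_halting t - prob_correct t) \<longlonglongrightarrow> 1 - suminf prob_correct"
    using sums_diff[OF prob_halting_sums summable_sums[OF summable_prob_correct]] by (simp add: sums_def_le)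
  then show "(\<lambda>T. (\<Sum>t<T. prob_running t) + c * (\<Sum>t\<le>T. prob_halting t - prob_correct t))
      \<longlonglongrightarrow> suminf prob_running + c * (1 - suminf prob_correct)"
    using summable_LIMSEQ[OF summable_prob_running] by (intro tendsto_intros)
  show "\<exists>T0. \<forall>T\<ge>T0. (\<Sum>t<T. prob_running t) + c * (\<Sum>t\<le>T. prob_halting t - prob_correct t) \<le> G (\<lambda>_. 1 / real M)"
    using cost_partial expected_cost_nonneg by (smt (verit))
qed

section \<open>Randomising between the strategy and stopping at time 0\<close>

definition enc :: "nat \<Rightarrow> nat \<Rightarrow> nat \<Rightarrow> 'y list \<Rightarrow> 'x" where
  "enc t u w ys = E (wt ys) w"

definition dec :: "nat \<Rightarrow> 'y list \<Rightarrow> nat" where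
  "dec u ys = guess (wt ys)"

lemma path_prob_enc: "path_prob W enc u w ys = real M * wt ys w"
  using path_prob_eq_weights[OF M] by (simp add: enc_def[abs_def])

text \<open>Let \<open>s\<close> be the success probability of the strategy. By
  \<open>cost_le\<close> its expected time is at most \<open>c - c * (1 - s) = c * s\<close>.
  Running it with probability \<open>(1 - \<epsilon>) / s\<close>, which is at most 1 because
  \<open>\<eta> \<le> \<epsilon>\<close>, keeps success at least \<open>1 - \<epsilon>\<close> and
  cuts the time to \<open>(1 - \<epsilon>) * c\<close>.\<close>

lemma time_sharing:
  assumes G: "G (\<lambda>_. 1 / real M) \<le> c" and \<eta>: "\<eta> \<le> \<epsilon>" and \<epsilon>: "0 < \<epsilon>" "\<epsilon> < 1"
  shows "\<exists>PU. is_vlf_code W ((1 - \<epsilon>) * c) M \<epsilon> PU enc stop dec"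
proof -
  define s where "s = suminf prob_correct"
  have s: "1 - \<epsilon> \<le> s" using prob_correct_ge \<eta> by (simp add: s_def)
  define p where "p = (1 - \<epsilon>) / s"
  have p: "0 < p" "p \<le> 1" "p * s = 1 - \<epsilon>" using s \<epsilon> by (auto simp: p_def field_simps)
  define PU where "PU = map_pmf (\<lambda>b. if b then 0 else 1 :: nat) (bernoulli_pmf p)"
  have sub: "set_pmf PU \<subseteq> {0, 1}" by (auto simp: PU_def)
  have pmf0: "pmf PU 0 = p"
  proof -
    have "pmf PU 0 = measure_pmf.prob (bernoulli_pmf p) {True}"
      unfolding PU_def pmf_map by (rule arg_cong[where f = "measure _"]) (auto split: if_splits)
    then show ?thesis using p by (simp add: measure_pmf_single)
  qed
  have sumPU: "(\<Sum>u\<in>set_pmf PU. pmf PU u / real M * f u) = (\<Sum>u\<in>{0,1}. pmf PU u / real M * f u)"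
    for f by (rule sum.mono_neutral_left) (use sub in \<open>auto simp: set_pmf_iff\<close>)
  have n1: "\<not> not_stopped stop 1 ys" for ys by (auto simp: not_stopped_def stop_def)
  have s1: "\<not> stops_at stop 1 ys" if "length ys \<noteq> 0" for ys using that by (auto simp: stops_at_def stop_def)
  have tau: "prob_tau_gt W M PU enc stop t = p * prob_running t" for t
  proof -
    have "prob_tau_gt W M PU enc stop t = p / real M * (\<Sum>w<M.
        \<Sum>ys\<in>{ys. length ys = t}. if not_stopped stop 0 ys then real M * wt ys w else 0)"
      unfolding prob_tau_gt_def sum_distrib_left[symmetric] sumPU
      by (simp add: n1 pmf0 path_prob_enc del: One_nat_def cong: if_cong)
    also have "\<dots> = p / real M * (real M * prob_running t)"
      unfolding prob_running_def total_def
      by (subst sum.swap) (auto simp: sum_distrib_left intro!: sum.cong)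
    finally show ?thesis using M by simp
  qed
  \<comment> \<open>Lucky guesses at time 0 when \<open>u = 1\<close>; they only add to the success
    probability.\<close>
  define r where "r t = pmf PU 1 / real M * (\<Sum>w<M. \<Sum>ys\<in>{ys. length ys = t}.
      if stops_at stop 1 ys \<and> dec 1 ys = w then path_prob W enc 1 w ys else 0)" for t
  have r_nonneg: "0 \<le> r t" for t
    unfolding r_def using Inv_nonneg[OF Inv_weights]
    by (intro mult_nonneg_nonneg sum_nonneg) (auto simp: path_prob_enc)
  have r0: "r t = 0" if "t \<notin> {0}" for t
    using that s1 unfolding r_def by (auto intro!: sum.neutral)
  have corr: "prob_correct_at W M PU enc stop dec t = p * prob_correct t + r t" for t
  proof -
    have "(\<Sum>w<M. \<Sum>ys\<in>{ys. length ys = t}.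
        if stops_at stop 0 ys \<and> dec 0 ys = w then path_prob W enc 0 w ys else 0) =
      (\<Sum>ys\<in>{ys. length ys = t}. \<Sum>w<M. if w = guess (wt ys) then
          if stops_at stop 0 ys then real M * wt ys w else 0 else 0)"
      by (subst sum.swap, intro sum.cong refl) (auto simp: dec_def path_prob_enc)
    also have "\<dots> = real M * prob_correct t"
      unfolding prob_correct_def sum_distrib_left using guess by (intro sum.cong refl) (simp add: sum.delta)
    finally show ?thesis
      unfolding prob_correct_at_def sum_distrib_left[symmetric] sumPU r_def
      using M by (simp add: pmf0 del: One_nat_def)
  qed
  have "is_vlf_code W ((1 - \<epsilon>) * c) M \<epsilon> PU enc stop dec"
    unfolding is_vlf_code_def
  proof (intro conjI allI)
    show "1 \<le> M" by (rule M)
    show "finite (set_pmf PU)" using sub finite_subset by blast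
    show "dec u ys < M" for u ys by (simp add: dec_def guess)
    show "summable (prob_tau_gt W M PU enc stop)"
      unfolding tau[abs_def] by (intro summable_mult summable_prob_running)
    have "suminf prob_running \<le> c * s" using cost_le G by (simp add: s_def algebra_simps)
    then have "p * suminf prob_running \<le> p * (c * s)" using p by (intro mult_left_mono) auto
    also have "\<dots> = (1 - \<epsilon>) * c" using p(3) by (simp add: mult_ac)
    finally show "(\<Sum>t. prob_tau_gt W M PU enc stop t) \<le> (1 - \<epsilon>) * c"
      unfolding tau suminf_mult[OF summable_prob_running] .
    have r: "summable r" "0 \<le> suminf r"
      using summable_finite[of "{0}" r] r0 r_nonneg by (auto intro!: suminf_nonneg)
    have "(\<Sum>t. prob_correct_at W M PU enc stop dec t) = p * s + suminf r"
      unfolding corr s_def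
      by (simp add: suminf_add[symmetric] summable_prob_correct r summable_mult suminf_mult)
    then show "1 - (\<Sum>t. prob_correct_at W M PU enc stop dec t) \<le> \<epsilon>" using p(3) r by simp
  qed
  then show ?thesis by blast
qed

end

end

subsection \<open>Codes from potentials\<close>

text \<open>If no divergence between rows is infinite, the rows are mutually absolutely
  continuous.\<close>

lemma common_support_of_C1:
  assumes "C1 W < \<infinity>"
  obtains S B x0 x1 where "common_support W S B"
    "real_of_ereal (C1 W) = (\<Sum>y\<in>S. pmf (W x0) y * ln (pmf (W x0) y / pmf (W x1) y))"
    "\<And>x x'. (\<Sum>y\<in>S. pmf (W x) y * ln (pmf (W x) y / pmf (W x') y)) \<le> real_of_ereal (C1 W)"
proof -
  have le: "kl_div (W x) (W x') \<le> C1 W" for x x'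
    unfolding C1_def by (rule Max_ge) (auto intro!: image_eqI[of _ _ "(x, x')"])
  have "C1 W \<in> (\<lambda>(x, x'). kl_div (W x) (W x')) ` UNIV"
    unfolding C1_def by (rule Max_in) auto
  then obtain x0 x1 where max: "C1 W = kl_div (W x0) (W x1)" by auto
  have ac: "pmf (W x') y = 0 \<Longrightarrow> pmf (W x) y = 0" for x x' y
    using le[of x x'] assms by (auto simp: kl_div_def split: if_splits)
  define S where "S = {y. pmf (W x0) y \<noteq> 0}"
  have kl: "kl_div (W x) (W x') = ereal (\<Sum>y\<in>S. pmf (W x) y * ln (pmf (W x) y / pmf (W x') y))" for x x'
  proof -
    have "(\<Sum>y\<in>UNIV. if pmf (W x) y = 0 then 0 else pmf (W x) y * ln (pmf (W x) y / pmf (W x') y)) =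
          (\<Sum>y\<in>S. pmf (W x) y * ln (pmf (W x) y / pmf (W x') y))"
      by (rule sum.mono_neutral_cong_right) (auto simp: S_def intro: ac)
    then show ?thesis unfolding kl_div_def using ac by auto
  qed
  define B where "B = (\<Sum>(x, x', y)\<in>UNIV. \<bar>ln (pmf (W x) y / pmf (W x') y)\<bar>)"
  have "common_support W S B"
  proof
    show "0 < pmf (W x) y" if "y \<in> S" for x y using that ac[of x y x0] by (auto simp: S_def order.strict_iff_order)
    show "pmf (W x) y = 0" if "y \<notin> S" for x y using that ac[of x0 y x] by (auto simp: S_def)
    show "\<bar>ln (pmf (W x) y / pmf (W x') y)\<bar> \<le> B" for x x' y
      unfolding B_def
      using member_le_sum[of "(x, x', y)" UNIV "\<lambda>(x, x', y). \<bar>ln (pmf (W x) y / pmf (W x') y)\<bar>"] by auto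
  qed
  moreover have "real_of_ereal (C1 W) = (\<Sum>y\<in>S. pmf (W x0) y * ln (pmf (W x0) y / pmf (W x1) y))"
    unfolding max kl by simp
  moreover have "(\<Sum>y\<in>S. pmf (W x) y * ln (pmf (W x) y / pmf (W x') y)) \<le> real_of_ereal (C1 W)" for x x'
    using le[of x x'] unfolding max kl by simp
  ultimately show ?thesis using that by blast
qed

context common_support
begin

text \<open>With two equally weighted messages in \<open>exists_encoder\<close>, each drift is a
  divergence between two rows.\<close>

lemma mutual_info_le_divergence:
  assumes "\<And>x x'. (\<Sum>y\<in>S. pmf (W x) y * ln (pmf (W x) y / pmf (W x') y)) \<le> D"
  shows "mutual_info P W \<le> D"
proof -
  let ?\<omega> = "\<lambda>_::nat. 1::real"
  have o: "others 2 \<omega> 0 = \<omega> 1" "others 2 \<omega> 1 = \<omega> 0" for \<omega>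
    by (simp_all add: others_eq lessThan_nat_numeral lessThan_Suc)
  obtain e where e: "mutual_info P W * (\<Sum>i<(2::nat). 1) \<le> (\<Sum>i<2. 1 * drift 2 ?\<omega> e i)"
    using exists_encoder[of 2 ?\<omega> "\<lambda>_. 1" P] by auto
  have "drift 2 ?\<omega> e 0 = (\<Sum>y\<in>S. pmf (W (e 0)) y * ln (pmf (W (e 0)) y / pmf (W (e 1)) y))"
    unfolding drift_def
    by (rule sum.cong) (use pmf_pos in \<open>simp_all add: increment_def log_odds_def o update_def\<close>)
  moreover have "drift 2 ?\<omega> e 1 = (\<Sum>y\<in>S. pmf (W (e 1)) y * ln (pmf (W (e 1)) y / pmf (W (e 0)) y))"
    unfolding drift_def
    by (rule sum.cong) (use pmf_pos in \<open>simp_all add: increment_def log_odds_def o update_def del: One_nat_def\<close>)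
  moreover have "(\<Sum>i<2. 1 * drift 2 ?\<omega> e i) = drift 2 ?\<omega> e 0 + drift 2 ?\<omega> e 1"
    by (simp add: numeral_2_eq_2)
  ultimately show ?thesis using e assms[of "e 0" "e 1"] assms[of "e 1" "e 0"] by simp
qed

text \<open>An error is priced at \<open>c\<close>, and halting at log odds \<open>ln N\<close>
  keeps the error probability at most \<open>1 / N\<close>. The hypothesis \<open>budget\<close>
  makes the initial cost at most \<open>c\<close>, as \<open>time_sharing\<close> requires.\<close>

lemma code_from_potential:
  fixes \<phi> :: "real \<Rightarrow> real" and x0 x1 :: 'x
  defines "D \<equiv> \<Sum>y\<in>S. pmf (W x0) y * ln (pmf (W x0) y / pmf (W x1) y)"
  assumes below: "\<forall>x<0. \<exists>m\<ge>0. \<forall>h. \<bar>h\<bar> \<le> B \<longrightarrow> \<phi> (x + h) \<le> \<phi> x - (p + m) * h + m * d"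
    and above: "\<forall>x\<ge>0. \<exists>m\<ge>0. \<forall>h. \<bar>h\<bar> \<le> B \<longrightarrow> \<phi> (x + h) \<le> \<phi> x - (a + m) * h + m * d"
    and lip: "\<forall>x h. \<bar>h\<bar> \<le> B \<longrightarrow> \<phi> (x + h) \<le> \<phi> x + L"
    and lower: "\<forall>x y. x \<le> y \<longrightarrow> 0 \<le> y \<longrightarrow> - a * y - K \<le> \<phi> x"
    and upper: "\<forall>x\<le>0. \<phi> x \<le> - p * x + K"
    and p: "0 \<le> p" "1 \<le> p * mutual_info P W" and d: "d \<le> mutual_info P W" "d \<le> D"
    and L: "0 \<le> L" and a: "1 + (1 + L) * exp (- l) \<le> a * D"
    and l: "0 \<le> l" "l \<le> ln N + B" and M: "2 \<le> M" and N: "0 < N" and c: "0 < c"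
    and budget: "p * (ln (real M) + l) + a * (ln N + B - l) + 2 * K + c / N \<le> c"
    and \<epsilon>: "1 / N \<le> \<epsilon>" "0 < \<epsilon>" "\<epsilon> < 1"
  shows "\<exists>PU f stop g. is_vlf_code W ((1 - \<epsilon>) * c) M \<epsilon> PU f stop g"
proof -
  \<comment> \<open>The offset makes \<open>v\<close> at least \<open>c / N\<close>, the price of
    halting, at all log odds up to \<open>ln N + B\<close>, the largest that can be reached by
    overshooting \<open>ln N\<close>.\<close>
  define v0 where "v0 = a * (ln N + B - l) + K + c / N"
  define v where "v x = v0 + \<phi> (x - l)" for x
  have v_ge: "c / N \<le> v x" if "x \<le> ln N + B" for x
    using lower[rule_format, of "x - l" "ln N + B - l"] that l by (simp add: v_def v0_def)
  define F where "F \<omega> = (\<Sum>i<M. \<omega> i * v (log_odds M \<omega> i))" for \<omega>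
  \<comment> \<open>Log odds at least \<open>ln N\<close>, written without division so that the zero
    vector counts as halted, at no cost.\<close>
  define halted where "halted \<omega> \<longleftrightarrow> (\<exists>i<M. N * others M \<omega> i \<le> \<omega> i)" for \<omega>
  define guess where "guess \<omega> = (if halted \<omega> then SOME i. i < M \<and> N * others M \<omega> i \<le> \<omega> i else 0)" for \<omega>
  define E where "E \<omega> = (SOME e. (\<Sum>y\<in>S. F (update W e y \<omega>)) \<le> F \<omega> - (\<Sum>i<M. \<omega> i))" for \<omega>
  \<comment> \<open>The zero vector arises from outputs outside \<open>S\<close>, over which the
    sums in \<open>posterior_strategy\<close> still range.\<close>
  define Inv where "Inv \<omega> \<longleftrightarrow> (\<forall>i<M. 0 < \<omega> i) \<or> (\<forall>i<M. \<omega> i = 0)" for \<omega> :: "nat \<Rightarrow> real"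
  define G where "G \<omega> = (if halted \<omega> then c * ((\<Sum>i<M. \<omega> i) - \<omega> (guess \<omega>)) else F \<omega>)" for \<omega>
  have guess_halted: "guess \<omega> < M \<and> N * others M \<omega> (guess \<omega>) \<le> \<omega> (guess \<omega>)" if "halted \<omega>" for \<omega>
    using that someI_ex[of "\<lambda>i. i < M \<and> N * others M \<omega> i \<le> \<omega> i"] by (auto simp: guess_def halted_def)
  have Inv_nonneg: "0 \<le> \<omega> i" if "Inv \<omega>" "i < M" for \<omega> i
    using that by (auto simp: Inv_def intro: less_imp_le)
  have others_nonneg: "0 \<le> others M \<omega> i" if "Inv \<omega>" for \<omega> i
    unfolding others_def using Inv_nonneg[OF that] by (intro sum_nonneg) auto
  have halted_error: "(\<Sum>i<M. \<omega> i) - \<omega> (guess \<omega>) \<le> (\<Sum>i<M. \<omega> i) / N" if "Inv \<omega>" "halted \<omega>" for \<omega>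
  proof -
    have "(\<Sum>i<M. \<omega> i) - \<omega> (guess \<omega>) = others M \<omega> (guess \<omega>)" using guess_halted[OF that(2)] by (simp add: others_eq)
    also have "\<dots> \<le> \<omega> (guess \<omega>) / N" using guess_halted[OF that(2)] N by (simp add: field_simps)
    also have "\<dots> \<le> (\<Sum>i<M. \<omega> i) / N"
      using guess_halted[OF that(2)] N Inv_nonneg[OF that(1)]
      by (intro divide_right_mono member_le_sum) auto
    finally show ?thesis .
  qed
  have running: "\<forall>i<M. 0 < \<omega> i" "\<And>i. i < M \<Longrightarrow> log_odds M \<omega> i \<le> ln N" if "Inv \<omega>" "\<not> halted \<omega>" for \<omega>
  proof -
    have "\<not> (\<forall>i<M. \<omega> i = 0)"
    proof
      assume "\<forall>i<M. \<omega> i = 0"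
      then have "N * others M \<omega> 0 \<le> \<omega> 0" using M by (simp add: others_def)
      then show False using that(2) M by (auto simp: halted_def)
    qed
    then show pos: "\<forall>i<M. 0 < \<omega> i" using that by (auto simp: Inv_def)
    fix i assume i: "i < M"
    have "0 < others M \<omega> i" using others_pos[OF M] pos by blast
    moreover have "\<omega> i \<le> N * others M \<omega> i" using that(2) i by (auto simp: halted_def not_le intro: less_imp_le)
    ultimately show "log_odds M \<omega> i \<le> ln N"
      using pos i N unfolding log_odds_def by (subst ln_le_cancel_iff) (auto simp: field_simps)
  qed
  have F_ge: "c / N * (\<Sum>i<M. \<omega> i) \<le> F \<omega>"
    if "\<And>i. i < M \<Longrightarrow> 0 \<le> \<omega> i" "\<And>i. i < M \<Longrightarrow> log_odds M \<omega> i \<le> ln N + B" for \<omega>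
  proof -
    have "(\<Sum>i<M. \<omega> i * (c / N)) \<le> F \<omega>"
      unfolding F_def using that by (intro sum_mono mult_left_mono v_ge) auto
    then show ?thesis by (simp only: sum_distrib_left mult.commute)
  qed
  have B0: "0 \<le> B"
  proof -
    have "S \<noteq> {}" using sum_support by force
    then obtain y where "y \<in> S" by blast
    from log_ratio_le[OF this, of x0 x0] pmf_pos[OF this, of x0] show ?thesis by simp
  qed
  interpret strategy: posterior_strategy W M E halted guess Inv G c "1 / N"
  proof
    show "1 \<le> M" using M by simp
    show "Inv (\<lambda>_. 1 / real M)" using M by (simp add: Inv_def)
    show "Inv (update W (E \<omega>) y \<omega>)" if "Inv \<omega>" for \<omega> y
      using that by (cases "y \<in> S") (auto simp: Inv_def update_def pmf_pos pmf_zero)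
    show "0 \<le> \<omega> i" if "Inv \<omega>" "i < M" for \<omega> i using that by (rule Inv_nonneg)
    show "guess \<omega> < M" for \<omega> using guess_halted[of \<omega>] M by (cases "halted \<omega>") (auto simp: guess_def)
    show "(\<Sum>y\<in>UNIV. G (update W (E \<omega>) y \<omega>)) \<le> G \<omega> - (\<Sum>i<M. \<omega> i)" if "Inv \<omega>" "\<not> halted \<omega>" for \<omega>
    proof -
      note pos = running[OF that]
      have ex: "\<exists>e. (\<Sum>y\<in>S. F (update W e y \<omega>)) \<le> F \<omega> - (\<Sum>i<M. \<omega> i)"
        unfolding F_def
        by (rule potential_decrease[OF M _ below above lip p d[unfolded D_def] L a[unfolded D_def] v_def])
          (use pos in blast)
      have "(\<Sum>y\<in>UNIV. G (update W (E \<omega>) y \<omega>)) = (\<Sum>y\<in>S. G (update W (E \<omega>) y \<omega>))"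
      proof (rule sum.mono_neutral_right)
        show "\<forall>y\<in>UNIV - S. G (update W (E \<omega>) y \<omega>) = 0"
        proof
          fix y assume "y \<in> UNIV - S"
          then have u: "update W (E \<omega>) y \<omega> = (\<lambda>_. 0)" by (auto simp: update_def pmf_zero)
          have "halted (\<lambda>_. 0)" using M by (auto simp: halted_def others_def intro!: exI[of _ 0])
          then show "G (update W (E \<omega>) y \<omega>) = 0" by (simp add: G_def u)
        qed
      qed auto
      also have "\<dots> \<le> (\<Sum>y\<in>S. F (update W (E \<omega>) y \<omega>))"
      proof (rule sum_mono)
        fix y assume y: "y \<in> S"
        let ?u = "update W (E \<omega>) y \<omega>"
        have u_pos: "0 < ?u i" if "i < M" for i using pos(1) that y by (simp add: update_pos)
        have u_odds: "log_odds M ?u i \<le> ln N + B" if "i < M" for i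
          using abs_increment_le[OF M pos(1) y that, of "E \<omega>"] pos(2)[OF that]
          unfolding increment_def by linarith
        have "c * ((\<Sum>i<M. ?u i) - ?u (guess ?u)) \<le> F ?u" if "halted ?u"
        proof -
          have "Inv ?u" using u_pos by (simp add: Inv_def)
          then have "c * ((\<Sum>i<M. ?u i) - ?u (guess ?u)) \<le> c * ((\<Sum>i<M. ?u i) / N)"
            using that c by (intro mult_left_mono halted_error) auto
          also have "\<dots> \<le> F ?u"
            using F_ge[of ?u] u_pos u_odds by (simp add: less_imp_le)
          finally show ?thesis .
        qed
        then show "G ?u \<le> F ?u" by (simp add: G_def)
      qed
      also have "\<dots> \<le> F \<omega> - (\<Sum>i<M. \<omega> i)" unfolding E_def by (rule someI_ex[OF ex])
      finally show ?thesis using that by (simp add: G_def)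
    qed
    show "0 \<le> G \<omega>" if "Inv \<omega>" for \<omega>
    proof (cases "halted \<omega>")
      case True
      then have "(\<Sum>i<M. \<omega> i) - \<omega> (guess \<omega>) = others M \<omega> (guess \<omega>)" using guess_halted by (simp add: others_eq)
      then show ?thesis using True c others_nonneg[OF that] by (simp add: G_def)
    next
      case False
      have "0 \<le> c / N * (\<Sum>i<M. \<omega> i)"
        using c N Inv_nonneg[OF that] by (intro mult_nonneg_nonneg sum_nonneg) auto
      also have "\<dots> \<le> F \<omega>"
        using running[OF that False] B0 Inv_nonneg[OF that] by (intro F_ge) force+
      finally show ?thesis using False by (simp add: G_def)
    qed
    show "c * ((\<Sum>i<M. \<omega> i) - \<omega> (guess \<omega>)) \<le> G \<omega>" if "halted \<omega>" for \<omega> using that by (simp add: G_def)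
    show "(1 - 1 / N) * (\<Sum>i<M. \<omega> i) \<le> \<omega> (guess \<omega>)" if "Inv \<omega>" "halted \<omega>" for \<omega>
      using halted_error[OF that] by (simp add: left_diff_distrib)
  qed
  have "G (\<lambda>_. 1 / real M) \<le> c"
  proof (cases "halted (\<lambda>_. 1 / real M)")
    case True
    then show ?thesis using M c by (simp add: G_def field_simps)
  next
    case False
    \<comment> \<open>The common initial log odds of all messages; the climb from here to
      \<open>l\<close> at price \<open>p\<close> gives the term \<open>p * (ln M + l)\<close> of the
      budget.\<close>
    let ?x = "- ln (real M - 1)"
    have odds: "log_odds M (\<lambda>_. 1 / real M) i = ?x" if "i < M" for i
    proof -
      have "1 / real M / others M (\<lambda>_. 1 / real M) i = inverse (real M - 1)"
        using that M by (simp add: others_eq divide_simps)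
      then show ?thesis using M by (simp add: log_odds_def ln_inverse)
    qed
    have "F (\<lambda>_. 1 / real M) = v ?x" using M by (simp add: F_def odds)
    also have "\<dots> \<le> v0 + (p * (ln (real M - 1) + l) + K)"
    proof -
      have "0 \<le> ln (real M - 1)" using M by (intro ln_ge_zero) linarith
      then have "\<phi> (?x - l) \<le> - p * (?x - l) + K" using l by (intro upper[rule_format]) linarith
      then show ?thesis by (simp add: v_def algebra_simps)
    qed
    also have "\<dots> \<le> v0 + (p * (ln (real M) + l) + K)"
      using M p by (intro add_mono mult_left_mono) auto
    also have "\<dots> \<le> c" using budget by (simp add: v0_def)
    finally show ?thesis using False by (simp add: G_def)
  qed
  then show ?thesis using strategy.time_sharing[of \<epsilon>] c \<epsilon> by auto
qed

end

section \<open>Choice of parameters and the asymptotic bound\<close>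

lemma exists_floor_exp:
  assumes "ln 2 \<le> X"
  obtains M :: nat where "2 \<le> M" "ln (real M) \<le> X" "X - ln 2 \<le> ln (real M)"
proof
  let ?M = "nat \<lfloor>exp X\<rfloor>"
  have "exp (ln 2) \<le> exp X" using assms by (subst exp_le_cancel_iff)
  then have e: "2 \<le> exp X" by simp
  then show M: "2 \<le> ?M" by (simp add: le_nat_iff le_floor_iff)
  have le: "real ?M \<le> exp X" "exp X \<le> 2 * real ?M" using e M by linarith+
  have M0: "0 < real ?M" using M by linarith
  show "ln (real ?M) \<le> X" using ln_mono[OF le(1) M0] by (simp only: ln_exp)
  have "ln (exp X) \<le> ln (2 * real ?M)" using le(2) by (rule ln_mono) simp
  then show "X - ln 2 \<le> ln (real ?M)" using ln_mult_pos[OF _ M0, of 2] by (simp only: ln_exp)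
qed

theorem theorem2:
  fixes W :: "'x::finite \<Rightarrow> 'y::finite pmf" and \<epsilon> :: real
  assumes "capacity W > 0" and "C1 W < \<infinity>" and "0 < \<epsilon>" and "\<epsilon> < 1"
  shows "\<exists>K. \<forall>\<^sub>F N in at_top. \<exists>M PU f stop g.
           is_vlf_code W N M \<epsilon> PU f stop g \<and>
           ln (real M) \<ge> N * capacity W / (1 - \<epsilon>)
                          - capacity W / real_of_ereal (C1 W) * ln N - ln (ln N) - K"
proof -
  define C where "C = capacity W"
  define D where "D = real_of_ereal (C1 W)"
  obtain S B x0 x1 where cs: "common_support W S B"
    and D: "D = (\<Sum>y\<in>S. pmf (W x0) y * ln (pmf (W x0) y / pmf (W x1) y))"
    and D_max: "\<And>x x'. (\<Sum>y\<in>S. pmf (W x) y * ln (pmf (W x) y / pmf (W x') y)) \<le> D"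
    using that unfolding D_def by (rule common_support_of_C1[OF assms(2)])
  interpret common_support W S B by (rule cs)
  have C: "0 < C" using assms(1) by (simp add: C_def)
  have near: "\<exists>P. c < mutual_info P W" if "c < C" for c
    using that unfolding C_def capacity_def by (elim less_cSupE) auto
  obtain P1 where "C / 2 < mutual_info P1 W" using near[of "C / 2"] C by auto
  then have CD: "C / 2 \<le> D" using mutual_info_le_divergence[of D P1] D_max by auto
  have "D \<le> (\<Sum>y\<in>S. pmf (W x0) y * B)" unfolding D
    using log_ratio_le[of _ x0 x1] by (intro sum_mono mult_left_mono) (auto simp: abs_le_iff)
  also have "\<dots> = B" by (simp add: sum_distrib_right[symmetric] sum_support)
  finally have DB: "D \<le> B" .
  have D0: "0 < D" and B0: "0 < B" using C CD DB by linarith+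
  \<comment> \<open>\<open>C / 2\<close> is a drift guaranteed in both regimes, and
    \<open>4 / C\<close> bounds both slopes for all large \<open>N\<close>; hence \<open>K\<close>
    and \<open>L\<close> do not depend on \<open>N\<close>.\<close>
  have "0 < C / 2" "C / 2 \<le> B" "0 \<le> 4 / C" using C CD DB by simp_all
  then obtain K L where K: "0 \<le> K" and L: "0 \<le> L" and
    pot: "\<And>p a. \<lbrakk>0 \<le> p; p \<le> 4 / C; 0 \<le> a; a \<le> 4 / C\<rbrakk> \<Longrightarrow> \<exists>\<phi>::real \<Rightarrow> real.
       (\<forall>x<0. \<exists>m\<ge>0. \<forall>h. \<bar>h\<bar> \<le> B \<longrightarrow> \<phi> (x + h) \<le> \<phi> x - (p + m) * h + m * (C / 2)) \<and>
       (\<forall>x\<ge>0. \<exists>m\<ge>0. \<forall>h. \<bar>h\<bar> \<le> B \<longrightarrow> \<phi> (x + h) \<le> \<phi> x - (a + m) * h + m * (C / 2)) \<and>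
       (\<forall>x h. \<bar>h\<bar> \<le> B \<longrightarrow> \<phi> (x + h) \<le> \<phi> x + L) \<and>
       (\<forall>x y. x \<le> y \<longrightarrow> 0 \<le> y \<longrightarrow> - a * y - K \<le> \<phi> x) \<and>
       (\<forall>x\<le>0. \<phi> x \<le> - p * x + K)"
    using that by (rule two_slope_potential)
  \<comment> \<open>In order: the loss from a rate \<open>1 / N\<close> below \<open>C\<close>, the
    perturbation of the potential with the price of halting, and the overshoot with the excess slope
    in the upper regime.\<close>
  define K1 where "K1 = 1 / (1 - \<epsilon>) + C * (2 * K + 1 / (1 - \<epsilon>)) + C / D * (2 * B + 1 + L)"
  define Y where "Y N = N * C / (1 - \<epsilon>) - C / D * ln N - ln (ln N) - K1" for N
  have "\<forall>\<^sub>F N in at_top. ln 2 \<le> Y N"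
  proof -
    have "0 < C / (1 - \<epsilon>)" using C assms by simp
    then have "\<forall>\<^sub>F N in at_top. ln 2 \<le> C / (1 - \<epsilon>) * N - C / D * ln N - ln (ln N) - K1"
      by real_asymp
    then show ?thesis by (simp add: Y_def mult.commute)
  qed
  moreover have "\<forall>\<^sub>F N in at_top. 1 + L \<le> ln N" by real_asymp
  ultimately have "\<forall>\<^sub>F N in at_top. ln 2 \<le> Y N \<and> 1 + L \<le> ln N \<and> 2 / C \<le> N \<and> 1 / \<epsilon> \<le> N \<and> 1 \<le> N"
    by (intro eventually_conj eventually_ge_at_top)
  then have "\<forall>\<^sub>F N in at_top. \<exists>M PU f stop g. is_vlf_code W N M \<epsilon> PU f stop g \<and>
           ln (real M) \<ge> N * C / (1 - \<epsilon>) - C / D * ln N - ln (ln N) - (K1 + ln 2)"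
  proof (rule eventually_mono)
    fix N :: real
    assume N: "ln 2 \<le> Y N \<and> 1 + L \<le> ln N \<and> 2 / C \<le> N \<and> 1 / \<epsilon> \<le> N \<and> 1 \<le> N"
    then have N0: "0 < N" and lnN: "0 < ln N" "1 \<le> ln N" using L by linarith+
    \<comment> \<open>A rate \<open>1/N\<close> below capacity costs only \<open>O(1)\<close> and avoids showing that the capacity is attained.\<close>
    define c where "c = C - 1 / N"
    \<comment> \<open>With \<open>exp (- l) = 1 / ln N\<close> the excess slope is of order
      \<open>1 / ln N\<close>, which over a range of about \<open>ln N\<close> costs only a
      constant.\<close>
    define l where "l = ln (ln N)"
    \<comment> \<open>The smallest slope allowed by \<open>potential_decrease\<close> at this
      level.\<close>
    define a where "a = (1 + (1 + L) / ln N) / D"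
    have "2 \<le> C * N" using N C by (simp add: field_simps)
    then have "1 / N \<le> C / 2" using N0 by (simp add: field_simps)
    then have c: "C / 2 \<le> c" "c < C" "0 < c" using N0 C by (auto simp: c_def)
    obtain P where P: "c < mutual_info P W" using near c by blast
    have "1 / c \<le> 1 / (C / 2)" using c C by (intro divide_left_mono) auto
    also have "\<dots> \<le> 4 / C" using C by (simp add: field_simps)
    finally have p: "0 \<le> 1 / c" "1 / c \<le> 4 / C" using c by simp_all
    have "(1 + L) / ln N \<le> 1" using N lnN by simp
    then have "a \<le> 2 / D" unfolding a_def using D0 by (intro divide_right_mono) auto
    also have "\<dots> \<le> 2 / (C / 2)" using CD C by (intro divide_left_mono) auto
    finally have a: "0 \<le> a" "a \<le> 4 / C" using D0 L lnN by (simp_all add: a_def)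
    have l: "0 \<le> l" "l \<le> ln N + B" and exp_l: "exp (- l) = 1 / ln N"
      using lnN B0 ln_le_minus_one[of "ln N"] by (auto simp: l_def exp_minus inverse_eq_divide)
    \<comment> \<open>Both the price of an error and the budget; \<open>time_sharing\<close> scales
      it to an expected time of \<open>N\<close>.\<close>
    define cc where "cc = N / (1 - \<epsilon>)"
    have cc: "0 < cc" "(1 - \<epsilon>) * cc = N" "cc / N = 1 / (1 - \<epsilon>)" using N0 assms by (auto simp: cc_def)
    \<comment> \<open>The budget inequality with \<open>p = 1 / c\<close>, solved for
      \<open>ln M\<close>.\<close>
    define X where "X = c * (cc - 2 * K - cc / N - a * (ln N + B - l)) - l"
    have YX: "Y N \<le> X"
    proof -
      have "c * cc = N * C / (1 - \<epsilon>) - 1 / (1 - \<epsilon>)"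
        using N0 by (simp add: c_def cc_def left_diff_distrib right_diff_distrib diff_divide_distrib mult.commute[of N])
      moreover have "c * (2 * K + 1 / (1 - \<epsilon>)) \<le> C * (2 * K + 1 / (1 - \<epsilon>))"
        using c K assms by (intro mult_right_mono) auto
      moreover have "c * (a * (ln N + B - l)) \<le> C / D * (ln N + 2 * B + 1 + L)"
      proof -
        have "c * (a * (ln N + B - l)) \<le> C * (a * (ln N + B))"
          using c a l lnN B0 C by (intro mult_mono) auto
        also have "\<dots> = C / D * ((1 + (1 + L) / ln N) * (ln N + B))" by (simp add: a_def)
        also have "(1 + (1 + L) / ln N) * (ln N + B) = ln N + B + (1 + L) + (1 + L) / ln N * B"
          using lnN by (simp add: field_simps)
        also have "C / D * (ln N + B + (1 + L) + (1 + L) / ln N * B) \<le> C / D * (ln N + 2 * B + 1 + L)"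
          using C D0 B0 mult_right_mono[OF \<open>(1 + L) / ln N \<le> 1\<close>, of B] by (intro mult_left_mono) auto
        finally show ?thesis .
      qed
      moreover have "X = c * cc - c * (2 * K + 1 / (1 - \<epsilon>)) - c * (a * (ln N + B - l)) - l"
        unfolding X_def cc(3) by (simp add: algebra_simps)
      moreover have "C / D * (ln N + 2 * B + 1 + L) = C / D * ln N + C / D * (2 * B + 1 + L)"
        by (simp add: algebra_simps)
      ultimately show ?thesis unfolding Y_def K1_def l_def by linarith
    qed
    then have "ln 2 \<le> X" using N by linarith
    then obtain M where M: "2 \<le> M" "ln (real M) \<le> X" "X - ln 2 \<le> ln (real M)"
      by (rule exists_floor_exp)
    obtain \<phi> :: "real \<Rightarrow> real" where \<phi>:
      "\<forall>x<0. \<exists>m\<ge>0. \<forall>h. \<bar>h\<bar> \<le> B \<longrightarrow> \<phi> (x + h) \<le> \<phi> x - (1 / c + m) * h + m * (C / 2)"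
      "\<forall>x\<ge>0. \<exists>m\<ge>0. \<forall>h. \<bar>h\<bar> \<le> B \<longrightarrow> \<phi> (x + h) \<le> \<phi> x - (a + m) * h + m * (C / 2)"
      "\<forall>x h. \<bar>h\<bar> \<le> B \<longrightarrow> \<phi> (x + h) \<le> \<phi> x + L"
      "\<forall>x y. x \<le> y \<longrightarrow> 0 \<le> y \<longrightarrow> - a * y - K \<le> \<phi> x"
      "\<forall>x\<le>0. \<phi> x \<le> - (1 / c) * x + K"
      using pot[OF p a] by blast
    have "\<exists>PU f stop g. is_vlf_code W ((1 - \<epsilon>) * cc) M \<epsilon> PU f stop g"
    proof (rule code_from_potential[OF \<phi> p(1), where P = P and l = l and N = N])
      show "1 \<le> 1 / c * mutual_info P W" using P c by simp
      show "C / 2 \<le> mutual_info P W" using P c by linarith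
      show "C / 2 \<le> (\<Sum>y\<in>S. pmf (W x0) y * ln (pmf (W x0) y / pmf (W x1) y))" using CD D by simp
      show "1 + (1 + L) * exp (- l) \<le> a * (\<Sum>y\<in>S. pmf (W x0) y * ln (pmf (W x0) y / pmf (W x1) y))"
        using D0 by (simp add: D[symmetric] exp_l a_def)
      have "ln (real M) + l \<le> c * (cc - 2 * K - cc / N - a * (ln N + B - l))"
        using M(2) by (simp add: X_def)
      then have "1 / c * (ln (real M) + l) \<le> cc - 2 * K - cc / N - a * (ln N + B - l)"
        using c by (simp add: pos_divide_le_eq mult.commute)
      then show "1 / c * (ln (real M) + l) + a * (ln N + B - l) + 2 * K + cc / N \<le> cc" by linarith
      show "1 / N \<le> \<epsilon>" using N N0 assms by (simp add: field_simps)
    qed (use L l M N0 cc assms in auto)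
    then show "\<exists>M PU f stop g. is_vlf_code W N M \<epsilon> PU f stop g \<and>
           ln (real M) \<ge> N * C / (1 - \<epsilon>) - C / D * ln N - ln (ln N) - (K1 + ln 2)"
      using M(3) YX unfolding cc(2) Y_def by (intro exI[of _ M]) auto
  qed
  then show ?thesis unfolding C_def D_def by blast
qed

end
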